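(* Notation ($F$, $c_1,c_2$, $\overline\alpha,\overline\beta,\overline\eta$, $\Lambda_2,\Lambda_3$, $f_4$) is as in the context. (1) Let $a,b_1,b_2\in(0,\infty)$ with $b_1<b_2$. If $b_1b_2>a(a+1)$, then neither of the (equivalent) inequalities $\Lambda_2(a,b_1,b_2,r)>1$ and $\Lambda_3(a,b_1,b_2,r)>F(a,b_1;c_1;r)$ is valid for all $r\in(0,1)$. In particular, it is not true that $$\frac{\partial}{\partial b}\left[\frac{F(a+1,b+1;a+b+1;r)}{F(a,b;a+b;r)}\right]<0$$ for all $a,b\in(0,\infty)$ and $r\in(0,1)$. (2) Let $a,b_1,b_2\in(0,\infty)$ with $b_1<b_2$. If $b_1b_2>a(a+1)$, then there is $r_4\in(0,1)$ such that $\Lambda_2(a,b_1,b_2,r)<1$ for $r\in(0,r_4)$. If $b_1b_2<a(a+1)$, then there is $r_5\in(0,1)$ such that $\Lambda_2(a,b_1,b_2,r)>1$ for $r\in(0,r_5)$. Moreover, for all $a,b_1,b_2\in(0,\infty)$ with $b_1<b_2$ there is $r_6\in(0,1)$ such that $\Lambda_2(a,b_1,b_2,r)>1$ for $r\in(r_6,1)$. In particular, neither the inequality $\Lambda_2(a,b_1,b_2,r)>1$ (equivalently, $\Lambda_3(a,b_1,b_2,r)>F(a,b_1;c_1;r)$) nor its reverse holds for all $a,b_1,b_2\in(0,\infty)$ and $r\in(0,1)$ with $b_1<b_2$. (3) For $a,b_1,b_2\in(0,\infty)$ with $b_1<b_2$, the function $r\mapsto f_4(a,b_1,b_2,r)$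 is strictly increasing from $(0,1)$ onto $\bigl(a(b_2-b_1)/(b_1c_2),\overline\alpha\,\overline\beta\bigr)$. In particular, for $a\in(0,\infty)$, $0<b_1\le b_2$ and $r\in(0,1)$, (A) $$\overline\alpha\left[F(a,b_1;c_1;r)-\overline\beta\right]\le\Lambda_3(a,b_1,b_2,r)\le\overline\alpha\left[F(a,b_1;c_1;r)-\overline\eta\right],$$ (B) $$\overline\alpha\left[1-\frac{\overline\beta}{F(a,b_1;c_1;r)}\right]\le\Lambda_2(a,b_1,b_2,r)\le\overline\alpha\left[1-\frac{\overline\eta}{F(a,b_1;c_1;r)}\right],$$ (C) $$\overline\alpha(1-\overline\beta)\le\Lambda_2(a,b_1,b_2,r)\le\overline\alpha,$$ with equality in each instance if and only if $b_1=b_2$. Moreover, as constants independent of $r$, the coefficients ($\overline\alpha$, $\overline\beta$, $\overline\eta$) in the lower and upper bounds in (A) and (B), and the upper bound $\overline\alpha$ in (C), are all best possible (none of them can be replaced, the others being kept fixed, by a constant independent of $r$ giving a sharper bound valid for all $r\in(0,1)$); (B) is sharp as $r\to1^-$ (its three members have a common limit), and (A), (B), (C) are all sharp as $a\to0^+$ (the three members have a common limit). (4) Let $a,b_1,b_2\in(0,\infty)$ with $b_1<b_2$, write $f_4(a,b_1,b_2,r)=\sum_{k=0}^\infty\tilde b_kr^k$ for $r\in(0,1)$ (with $\tilde b_k=\tilde b_k(a,b_1,b_2)$), put $\eta_n=\overline\alpha\,\overline\beta-\sum_{k=0}^{n+1}\tilde b_k$ for $n\in\mathbb{N}_0$, and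 for $a\in(1,\infty)$ let $$\bar b=\frac{\sqrt{a^2+4a-1}-\sqrt{a^2-1}}{2}\sqrt{\frac{a+1}{a-1}}\quad(>1).$$ Suppose that either $a\in(0,1]$, or $a\in(1,\infty)$ and $b_2\in(0,\bar b]$. Then $f_4$ is absolutely monotone in $r$ from $(0,1)$ onto $\bigl(a(b_2-b_1)/(b_1c_2),\overline\alpha\,\overline\beta\bigr)$. In particular, for each $n\in\mathbb{N}_0$ and all $r\in(0,1)$, $$\sum_{k=0}^{n+2}\tilde b_kr^k<\overline\alpha F(a,b_1;c_1;r)-\Lambda_3(a,b_1,b_2,r)<\sum_{k=0}^{n+1}\tilde b_kr^k+\eta_nr^{n+2}$$ and $$\overline\alpha(1-\overline\beta)<\overline\alpha-\frac{\sum_{k=0}^{n+1}\tilde b_kr^k+\eta_nr^{n+2}}{F(a,b_1;c_1;r)}<\Lambda_2(a,b_1,b_2,r)<\overline\alpha-\frac{\sum_{k=0}^{n+2}\tilde b_kr^k}{F(a,b_1;c_1;r)}<\overline\alpha.$$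
   Context: $\mathbb{N}_0=\{0,1,2,\dots\}$. $\Gamma$ is the gamma function, $\psi=\Gamma'/\Gamma$, $B(x,y)=\Gamma(x)\Gamma(y)/\Gamma(x+y)$. $(a)_0=1$, $(a)_n=a(a+1)\cdots(a+n-1)$. For $|x|<1$, $F(a,b;c;x)=\sum_{n=0}^\infty\frac{(a)_n(b)_n}{(c)_n\,n!}x^n$ (Gaussian hypergeometric function). For $a,b_1,b_2\in(0,\infty)$ put $c_1=a+b_1$, $c_2=a+b_2$ and $$\overline\alpha=\frac{b_2c_1}{b_1c_2},\qquad \overline\eta=\frac{a(b_2-b_1)}{b_2c_1},\qquad \overline\beta=\frac{\psi(b_2)-\psi(b_1)}{B(a,b_1)}.$$ For $r\in(0,1)$, $$\Lambda_2(a,b_1,b_2,r)=\frac{F(a,b_1;c_1+1;r)F(a,b_2;c_2;r)}{F(a,b_1;c_1;r)F(a,b_2;c_2+1;r)},\qquad \Lambda_3(a,b_1,b_2,r)=\Lambda_2(a,b_1,b_2,r)F(a,b_1;c_1;r),$$ $$f_4(a,b_1,b_2,r)=\overline\alpha F(a,b_1;c_1;r)-\Lambda_3(a,b_1,b_2,r).$$ A function is absolutely monotone on an interval if it and all its derivatives are nonnegative there. *)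

theory Defs
  imports "HOL-Analysis.Analysis"
begin

definition hyp2F1 :: "real \<Rightarrow> real \<Rightarrow> real \<Rightarrow> real \<Rightarrow> real" where
  "hyp2F1 a b c x = eval_fps (fps_hypergeo [a, b] [c] 1) x"

lemma hyp2F1_altdef:
  "hyp2F1 a b c x =
     (\<Sum>n. pochhammer a n * pochhammer b n / (pochhammer c n * fact n) * x ^ n)"
  by (simp add: hyp2F1_def eval_fps_def)

text \<open>Throughout, \<open>c\<^sub>1 = a + b\<^sub>1\<close> and \<open>c\<^sub>2 = a + b\<^sub>2\<close> are written out.\<close>

definition alpha_bar :: "real \<Rightarrow> real \<Rightarrow> real \<Rightarrow> real" where
  "alpha_bar a b1 b2 = b2 * (a + b1) / (b1 * (a + b2))"

definition eta_bar :: "real \<Rightarrow> real \<Rightarrow> real \<Rightarrow> real" where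
  "eta_bar a b1 b2 = a * (b2 - b1) / (b2 * (a + b1))"

definition beta_bar :: "real \<Rightarrow> real \<Rightarrow> real \<Rightarrow> real" where
  "beta_bar a b1 b2 = (Digamma b2 - Digamma b1) / Beta a b1"

definition Lambda2 :: "real \<Rightarrow> real \<Rightarrow> real \<Rightarrow> real \<Rightarrow> real" where
  "Lambda2 a b1 b2 r =
     (hyp2F1 a b1 (a + b1 + 1) r * hyp2F1 a b2 (a + b2) r) /
     (hyp2F1 a b1 (a + b1) r * hyp2F1 a b2 (a + b2 + 1) r)"

definition Lambda3 :: "real \<Rightarrow> real \<Rightarrow> real \<Rightarrow> real \<Rightarrow> real" where
  "Lambda3 a b1 b2 r = Lambda2 a b1 b2 r * hyp2F1 a b1 (a + b1) r"

definition f4 :: "real \<Rightarrow> real \<Rightarrow> real \<Rightarrow> real \<Rightarrow> real" where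
  "f4 a b1 b2 r = alpha_bar a b1 b2 * hyp2F1 a b1 (a + b1) r - Lambda3 a b1 b2 r"

definition b_bar :: "real \<Rightarrow> real" where
  "b_bar a = (sqrt (a\<^sup>2 + 4 * a - 1) - sqrt (a\<^sup>2 - 1)) / 2 * sqrt ((a + 1) / (a - 1))"

text \<open>Intended for open \<open>S\<close>. Differentiability is required explicitly because \<^const>\<open>deriv\<close> is a
  total operator with an unspecified value where no derivative exists.\<close>

definition absolutely_monotone_on :: "(real \<Rightarrow> real) \<Rightarrow> real set \<Rightarrow> bool" where
  "absolutely_monotone_on f S \<longleftrightarrow>
     (\<forall>n. \<forall>x\<in>S. (deriv ^^ n) f differentiable (at x) \<and> 0 \<le> (deriv ^^ n) f x)"

end

(*
  Write F_i = F(a,b_i;c_i;.), G_i = F(a,b_i;c_i+1;.) and let w_i = r G_i'/G_i. The contiguous relation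
  F_i = G_i (1 + w_i/c_i) turns f_4 into alpha F_1 - G_1 (1 + w_2/c_2), and the hypergeometric equation
  of G_i becomes the Riccati equation r w' + w^2 + c w = a b r/(1-r). It has two consequences.

  (i) r f_4' = G_1 (1 + w_2/c_2) (w_2 - w_1).

  (ii) The coefficients of w satisfy a quadratic recurrence. Differencing it twice shows inductively
  that they are nonnegative and nonincreasing from index 1 on; differencing the recurrence of
  w_2 - w_1 then shows that they increase with b.

  Hence all Taylor coefficients of f_4 are positive. The value at 1 comes from
  sum_n (t_n(x) - t_n(y)) = psi(y) - psi(x) for t_n(b) = B(a,b) (a)_n (b)_n / ((a+b)_n n!):
  both sides are monotone in y and increase by 1/y when y is replaced by y + 1, which determines them.
*)
theory Submission
  imports Defs
begin

section \<open>The logarithmic derivative of the contiguous function\<close>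

text \<open>The quadratic recurrence carries its convolution with a minus sign, so no sign can be
  read off it directly. Differencing removes the constant a b, and after the second differencing the
  convolution of the differences d_n = w_n - w_(n+1) comes with a plus sign. The one bad term is d_0
  = -w_1, which occurs twice; w_1 = a b / (a + b + 1) lies below both a and b, so the linear term
  absorbs it. The bounds 0 \<le> w_n \<le> a also give w radius of convergence at least 1, with
  nothing known about complex zeros of G, by which w divides. The constant \<alpha> does two jobs.
  Its value makes the sources of the two Riccati equations cancel in r f_4', and it equals B(a,b_1)
  G_1(1) / (B(a,b_2) G_2(1)), so that the logarithmic divergences of F_1 and F_2 at 1 cancel. Each
  F_i grows only like a logarithm, while G_i approaches G_i(1) with error at most of order sqrt(1 -
  r); hence G_i may be replaced by G_i(1) in front of F_2.\<close>

text \<open>The zero-balanced series \<open>F(a,b;a+b;\<cdot>)\<close> and its contiguous neighbour \<open>F(a,b;a+b+1;\<cdot>)\<close>.\<close>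

definition zbal :: "real \<Rightarrow> real \<Rightarrow> real fps" where
  "zbal a b = fps_hypergeo [a, b] [a + b] 1"

definition zbal1 :: "real \<Rightarrow> real \<Rightarrow> real fps" where
  "zbal1 a b = fps_hypergeo [a, b] [a + b + 1] 1"

definition fps_theta :: "real fps \<Rightarrow> real fps" where
  "fps_theta f = fps_X * fps_deriv f"

definition logder :: "real \<Rightarrow> real \<Rightarrow> real fps" where
  "logder a b = fps_theta (zbal1 a b) * inverse (zbal1 a b)"

lemma fps_theta_nth [simp]: "fps_nth (fps_theta f) n = real n * fps_nth f n"
  by (cases n) (simp_all add: fps_theta_def)

lemma fps_theta_add: "fps_theta (f + g) = fps_theta f + fps_theta g"
  and fps_theta_diff: "fps_theta (f - g) = fps_theta f - fps_theta g"
  and fps_theta_mult: "fps_theta (f * g) = fps_theta f * g + f * fps_theta g"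
  and fps_theta_const: "fps_theta (fps_const k) = 0"
  and fps_theta_one: "fps_theta 1 = 0"
  by (simp_all add: fps_theta_def algebra_simps)

lemma zbal_nth:
  "fps_nth (zbal a b) n = pochhammer a n * pochhammer b n / (pochhammer (a + b) n * fact n)"
  and zbal1_nth:
  "fps_nth (zbal1 a b) n = pochhammer a n * pochhammer b n / (pochhammer (a + b + 1) n * fact n)"
  by (simp_all add: zbal_def zbal1_def)

lemma zbal1_nth_0 [simp]: "fps_nth (zbal1 a b) 0 = 1"
  by (simp add: zbal1_nth)

lemma zbal_nth_0 [simp]: "fps_nth (zbal a b) 0 = 1"
  by (simp add: zbal_nth)

lemma zbal1_nz [simp]: "zbal1 a b \<noteq> 0"
  by (metis zbal1_nth_0 fps_zero_nth zero_neq_one)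

lemma zbal1_pos: "a > 0 \<Longrightarrow> b > 0 \<Longrightarrow> fps_nth (zbal1 a b) n > 0"
  and zbal_pos: "a > 0 \<Longrightarrow> b > 0 \<Longrightarrow> fps_nth (zbal a b) n > 0"
  by (simp_all add: zbal1_nth zbal_nth pochhammer_pos)

lemma logder_mult: "logder a b * zbal1 a b = fps_theta (zbal1 a b)"
  by (simp add: logder_def mult.assoc inverse_mult_eq_1)

text \<open>(a + b)_(n+1) splits off its first or its last factor. Comparing the two, passing from c
  = a + b + 1 to c = a + b multiplies the n-th coefficient by (a + b + n)/(a + b), which is the
  operator 1 + \<open>fps_theta\<close>/(a + b).\<close>

lemma zbal_nth_zbal1:
  assumes "a > 0" "b > 0"
  shows "(a + b) * fps_nth (zbal a b) n = (a + b + n) * fps_nth (zbal1 a b) n"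
proof -
  have "pochhammer (a + b) (Suc n) = (a + b) * pochhammer (a + b + 1) n"
    by (simp add: pochhammer_rec)
  moreover have "pochhammer (a + b) (Suc n) = (a + b + n) * pochhammer (a + b) n"
    by (simp add: pochhammer_rec')
  ultimately have eq: "(a + b) * pochhammer (a + b + 1) n = (a + b + n) * pochhammer (a + b) n"
    by simp
  have "pochhammer (a + b) n > 0" "pochhammer (a + b + 1) n > 0"
    using assms by (auto intro!: pochhammer_pos)
  then have "(a + b) / pochhammer (a + b) n = (a + b + n) / pochhammer (a + b + 1) n"
    using eq by (simp add: frac_eq_eq)
  moreover have "(a + b) * fps_nth (zbal a b) n =
      (a + b) / pochhammer (a + b) n * (pochhammer a n * pochhammer b n / fact n)"
    by (simp add: zbal_nth)
  moreover have "(a + b + n) * fps_nth (zbal1 a b) n =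
      (a + b + n) / pochhammer (a + b + 1) n * (pochhammer a n * pochhammer b n / fact n)"
    by (simp add: zbal1_nth)
  ultimately show ?thesis by simp
qed

lemma zbal_conv_logder:
  assumes "a > 0" "b > 0"
  shows "zbal a b = zbal1 a b * (1 + fps_const (1 / (a + b)) * logder a b)"
proof -
  have "zbal1 a b * (1 + fps_const (1 / (a + b)) * logder a b) =
      zbal1 a b + fps_const (1 / (a + b)) * fps_theta (zbal1 a b)"
    unfolding logder_mult [symmetric] by (simp add: algebra_simps)
  also have "\<dots> = zbal a b"
  proof (rule fps_ext)
    fix n
    show "fps_nth (zbal1 a b + fps_const (1 / (a + b)) * fps_theta (zbal1 a b)) n =
        fps_nth (zbal a b) n"
      using zbal_nth_zbal1[OF assms, of n] assms by (simp add: field_simps)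
  qed
  finally show ?thesis by simp
qed

section \<open>The hypergeometric equation and the Riccati equation\<close>

lemma zbal1_nth_Suc:
  assumes "a > 0" "b > 0"
  shows "(1 + real n) * (1 + real n + a + b) * fps_nth (zbal1 a b) (Suc n) =
         (a + n) * (b + n) * fps_nth (zbal1 a b) n"
proof -
  have "pochhammer (a + b + 1) n > 0" "a + b + 1 + n > 0"
    using assms by (auto intro!: pochhammer_pos)
  moreover have "fps_nth (zbal1 a b) (Suc n) =
     (pochhammer a n * pochhammer b n * ((a + n) * (b + n))) /
     (pochhammer (a + b + 1) n * fact n * ((1 + real n) * (a + b + 1 + n)))"
    by (simp add: zbal1_nth pochhammer_rec' mult_ac)
  ultimately show ?thesis
    by (simp add: zbal1_nth add_ac)
qed

text \<open>This is theta (theta + a + b) G = X (theta + a)(theta + b) G, expanded. Because the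
  lower parameter is a + b + 1, the operator theta^2 + (a + b) theta occurs on both sides; this is
  why the Riccati equation has a pure multiple of X/(1 - X) as its source.\<close>

lemma zbal1_ode:
  assumes "a > 0" "b > 0"
  defines "G \<equiv> zbal1 a b"
  shows "fps_theta (fps_theta G) + fps_const (a + b) * fps_theta G =
         fps_X * (fps_theta (fps_theta G) + fps_const (a + b) * fps_theta G + fps_const (a * b) * G)"
proof (rule fps_ext)
  fix n
  show "fps_nth (fps_theta (fps_theta G) + fps_const (a + b) * fps_theta G) n =
         fps_nth (fps_X * (fps_theta (fps_theta G) + fps_const (a + b) * fps_theta G + fps_const (a * b) * G)) n"
    using zbal1_nth_Suc[OF assms(1,2), of "n - 1"]
    by (cases n) (simp_all add: G_def algebra_simps)
qed

text \<open>X/(1 - X), given by coefficients so that the Riccati equation contributes the same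
  constant a b at every index n > 0.\<close>

definition fps_geom :: "real fps" where
  "fps_geom = Abs_fps (\<lambda>n. if n = 0 then 0 else 1)"

lemma fps_geom_mult: "fps_geom * (1 - fps_X) = fps_X"
proof (rule fps_ext)
  fix n
  show "fps_nth (fps_geom * (1 - fps_X)) n = fps_nth fps_X n"
    by (cases n; cases "n - 1") (simp_all add: fps_geom_def algebra_simps)
qed

lemma logder_riccati:
  assumes "a > 0" "b > 0"
  defines "w \<equiv> logder a b"
  shows "fps_theta w + w * w + fps_const (a + b) * w = fps_const (a * b) * fps_geom"
proof -
  define G where "G = zbal1 a b"
  define A where "A = fps_theta w + w * w + fps_const (a + b) * w"
  have 1: "fps_theta G = w * G" by (simp add: w_def G_def logder_mult)
  have 2: "fps_theta (fps_theta G) = (fps_theta w + w * w) * G"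
    unfolding 1 fps_theta_mult by (simp add: 1 algebra_simps)
  \<comment> \<open>In terms of \<open>A\<close> the hypergeometric equation is linear, and G can be
    cancelled from it.\<close>
  have "A * G = fps_theta (fps_theta G) + fps_const (a + b) * fps_theta G"
    unfolding 2 unfolding 1 A_def by (simp add: algebra_simps)
  also have "\<dots> = fps_X * (A * G + fps_const (a * b) * G)"
    using zbal1_ode[OF assms(1,2), folded G_def] calculation by simp
  finally have "A * G - fps_X * (A * G) = fps_X * (fps_const (a * b) * G)"
    by (metis add_diff_cancel_left' distrib_left)
  hence "(A * (1 - fps_X)) * G = (fps_const (a * b) * fps_X) * G" by (simp add: algebra_simps)
  hence "A * (1 - fps_X) = fps_const (a * b) * fps_X"
    by (simp add: G_def)
  also have "\<dots> = fps_const (a * b) * fps_geom * (1 - fps_X)"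
    by (simp only: mult.assoc fps_geom_mult)
  finally show ?thesis
    by (simp add: A_def)
qed

section \<open>Recurrence, sign and monotonicity of the coefficients of w\<close>

lemma logder_nth_0 [simp]: "fps_nth (logder a b) 0 = 0"
  by (simp add: logder_def)

text \<open>As w_0 = 0, the convolution involves only w_1, ..., w_(n-1), so this determines
  w_n.\<close>

lemma logder_rec:
  assumes "a > 0" "b > 0" "n > 0"
  shows "(n + a + b) * fps_nth (logder a b) n =
         a * b - (\<Sum>i=0..n. fps_nth (logder a b) i * fps_nth (logder a b) (n - i))"
proof -
  have "fps_nth (fps_theta (logder a b) + logder a b * logder a b + fps_const (a + b) * logder a b) n =
        fps_nth (fps_const (a * b) * fps_geom) n"
    by (simp only: logder_riccati[OF assms(1,2)])
  thus ?thesis using assms(3) by (simp add: fps_mult_nth[of "logder a b"] fps_geom_def algebra_simps)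
qed

lemma logder_nth_1:
  assumes "a > 0" "b > 0"
  shows "fps_nth (logder a b) (Suc 0) = a * b / (a + b + 1)"
  using logder_rec[OF assms, of 1] assms by (simp add: field_simps)

text \<open>This smallness of w_1 keeps the linear coefficients nonnegative in the inductions of
  \<open>logder_nth_Suc_le\<close>, \<open>logder_nth_nonneg\<close> and
  \<open>logder_nth_mono\<close>.\<close>

lemma logder_nth_1_less:
  assumes "a > 0" "b > 0"
  shows "fps_nth (logder a b) (Suc 0) < a" "fps_nth (logder a b) (Suc 0) < b"
  using assms by (simp_all add: logder_nth_1 field_simps add_pos_pos)

text \<open>The extra term i = n + 1 carries v 0 = 0, so differencing a convolution falls on one
  factor only.\<close>

lemma convolution_Suc_diff:
  fixes u v :: "nat \<Rightarrow> real"
  assumes "v 0 = 0"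
  shows "(\<Sum>i=0..Suc n. u i * v (Suc n - i)) - (\<Sum>i=0..n. u i * v (n - i)) =
         (\<Sum>i=0..n. u i * (v (Suc (n - i)) - v (n - i)))"
  using assms by (simp add: sum_subtractf right_diff_distrib Suc_diff_le)

text \<open>The first identity is the difference of \<open>logder_rec\<close> at n and n + 1; for n
  > 0 both sources equal a b and cancel. The second compares the first at n and n + 1. It is free of
  w: only differences remain, with a plus sign before the convolution.\<close>

lemma logder_diff_rec:
  fixes a b :: real
  defines "d \<equiv> \<lambda>n. fps_nth (logder a b) n - fps_nth (logder a b) (Suc n)"
  assumes "a > 0" "b > 0" "n > 0"
  shows "(real n + 1 + a + b) * d n =
         fps_nth (logder a b) n - (\<Sum>i=0..n. fps_nth (logder a b) i * d (n - i))" (is ?th1)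
    and "(real n + 2 + a + b) * d (Suc n) = (n + a + b) * d n + (\<Sum>i=0..n. d i * d (n - i))" (is ?th2)
proof -
  let ?w = "fps_nth (logder a b)"
  have *: "(real n + 1 + a + b) * d n = ?w n - (\<Sum>i=0..n. ?w i * d (n - i))" if "n > 0" for n
  proof -
    have "(real n + 1 + a + b) * d n = (n + a + b) * ?w n + ?w n - (Suc n + a + b) * ?w (Suc n)"
      by (simp add: d_def algebra_simps)
    also have "\<dots> = ?w n + (\<Sum>i=0..n. ?w i * (?w (Suc (n - i)) - ?w (n - i)))"
      unfolding logder_rec[OF assms(2,3) that] logder_rec[OF assms(2,3) zero_less_Suc]
        convolution_Suc_diff[symmetric, of ?w, OF logder_nth_0] by simp
    also have "(\<Sum>i=0..n. ?w i * (?w (Suc (n - i)) - ?w (n - i))) = - (\<Sum>i=0..n. ?w i * d (n - i))"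
      unfolding d_def sum_negf [symmetric] by (intro sum.cong) (simp_all add: algebra_simps)
    finally show ?thesis by simp
  qed
  show ?th1 by (rule *) fact
  have "(real n + 2 + a + b) * d (Suc n) = ?w (Suc n) - (\<Sum>i=0..Suc n. ?w i * d (Suc n - i))"
    using *[of "Suc n"] by (simp add: algebra_simps)
  \<comment> \<open>The term i = 0 vanishes because w_0 = 0. Writing w_(i+1) = w_i - d_i in the
    shifted sum makes the convolution of the first identity at n reappear.\<close>
  also have "(\<Sum>i=0..Suc n. ?w i * d (Suc n - i)) = (\<Sum>i=0..n. ?w (Suc i) * d (n - i))"
    unfolding sum.atLeast0_atMost_Suc_shift by (simp del: sum.cl_ivl_Suc)
  also have "\<dots> = (\<Sum>i=0..n. ?w i * d (n - i)) - (\<Sum>i=0..n. d i * d (n - i))"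
    unfolding sum_subtractf [symmetric] by (intro sum.cong) (simp_all add: d_def algebra_simps)
  also have "?w (Suc n) = ?w n - d n" by (simp add: d_def)
  finally show ?th2 using *[OF assms(4)] by (simp add: algebra_simps)
qed

text \<open>In the second identity of \<open>logder_diff_rec\<close> the products d_i d_(m-i) with 0
  < i < m are nonnegative by induction. The two ends contribute 2 d_0 d_m = -2 w_1 d_m, which (m + a
  + b) d_m outweighs because w_1 < a and w_1 < b. The case n = 1 is separate since that identity
  starts from a positive index.\<close>

lemma logder_nth_Suc_le:
  assumes "a > 0" "b > 0" "n > 0"
  shows "fps_nth (logder a b) (Suc n) \<le> fps_nth (logder a b) n"
proof -
  let ?w = "fps_nth (logder a b)"
  define d where "d n = ?w n - ?w (Suc n)" for n
  have w1: "?w 1 > 0" "?w 1 < a" "?w 1 < b"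
    using assms logder_nth_1_less[OF assms(1,2)] by (auto simp: logder_nth_1)
  have d0: "d 0 = - ?w 1" by (simp add: d_def)
  have "d n \<ge> 0" using assms(3)
  proof (induction n rule: less_induct)
    case (less n)
    show ?case
    proof (cases "n = 1")
      case True
      have "(2 + a + b) * d 1 = ?w 1 - ?w 1 * d 0"
        using logder_diff_rec(1)[OF assms(1,2), of 1] by (simp add: d_def)
      also have "\<dots> \<ge> 0" using w1 by (simp add: d0)
      finally show ?thesis using assms True by (simp add: zero_le_mult_iff)
    next
      case False
      then obtain m where m: "n = Suc m" "m > 0" using less.prems by (cases n) auto
      have "(\<Sum>i=0..m. d i * d (m - i)) =
            d 0 * d m + d m * d 0 + (\<Sum>i=Suc 0..<m. d i * d (m - i))"
        using m(2) sum.last_plus[of 0 m "\<lambda>i. d i * d (m - i)"]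
        by (simp add: sum.atLeast_Suc_lessThan)
      moreover have "(\<Sum>i=Suc 0..<m. d i * d (m - i)) \<ge> 0"
        by (intro sum_nonneg mult_nonneg_nonneg less.IH) (auto simp: m)
      ultimately have "(real m + 2 + a + b) * d n \<ge> (m + a + b - 2 * ?w 1) * d m"
        using logder_diff_rec(2)[OF assms(1,2) m(2)] unfolding d_def[symmetric] m(1)
        by (simp add: d0 algebra_simps)
      moreover have "(m + a + b - 2 * ?w 1) * d m \<ge> 0"
        using w1 less.IH[of m] m by (intro mult_nonneg_nonneg) auto
      ultimately have "(real m + 2 + a + b) * d n \<ge> 0" by linarith
      thus ?thesis using assms by (simp add: zero_le_mult_iff)
    qed
  qed
  thus ?thesis by (simp add: d_def)
qed

text \<open>Solved for w_(m+1), the first difference identity has only nonnegative terms: its end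
  term w_m d_0 = -w_m w_1 is absorbed by (m + a + b) w_m, and the other differences are nonnegative
  by \<open>logder_nth_Suc_le\<close>.\<close>

lemma logder_nth_nonneg:
  assumes "a > 0" "b > 0"
  shows "fps_nth (logder a b) n \<ge> 0"
proof (induction n rule: less_induct)
  case (less n)
  let ?w = "fps_nth (logder a b)"
  consider "n = 0" | "n = 1" | m where "n = Suc m" "m > 0"
    by (cases n) auto
  thus ?case
  proof cases
    case 3
    define d where "d n = ?w n - ?w (Suc n)" for n
    have "(real m + 1 + a + b) * d m = ?w m - (\<Sum>i=0..m. ?w i * d (m - i))"
      using logder_diff_rec(1)[OF assms 3(2)] by (simp add: d_def)
    also have "(\<Sum>i=0..m. ?w i * d (m - i)) = (\<Sum>i=0..<m. ?w i * d (m - i)) - ?w m * ?w 1"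
      using 3 by (simp add: sum.last_plus atLeast0AtMost lessThan_atLeast0 d_def flip: lessThan_Suc_atMost)
    finally have "(real m + 1 + a + b) * ?w n = (m + a + b - ?w 1) * ?w m + (\<Sum>i=0..<m. ?w i * d (m - i))"
      by (simp add: d_def 3 algebra_simps)
    moreover have "(\<Sum>i=0..<m. ?w i * d (m - i)) \<ge> 0"
      by (intro sum_nonneg mult_nonneg_nonneg less.IH)
        (auto simp: 3 d_def intro!: logder_nth_Suc_le assms)
    moreover have "(m + a + b - ?w 1) * ?w m \<ge> 0"
      using logder_nth_1_less[OF assms] less.IH[of m] 3 assms by (intro mult_nonneg_nonneg) auto
    ultimately have "(real m + 1 + a + b) * ?w n \<ge> 0" by linarith
    thus ?thesis using assms by (simp add: zero_le_mult_iff)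
  qed (use assms in \<open>auto simp: logder_nth_1\<close>)
qed

lemma logder_nth_le:
  assumes "a > 0" "b > 0"
  shows "fps_nth (logder a b) n \<le> a"
proof (cases n)
  case (Suc m)
  have "fps_nth (logder a b) (Suc m) \<le> fps_nth (logder a b) (Suc 0)"
  proof (induction m)
    case (Suc m)
    thus ?case using logder_nth_Suc_le[OF assms, of "Suc m"] by simp
  qed auto
  thus ?thesis using logder_nth_1_less[OF assms] Suc by simp
qed (use assms in auto)

lemma logder_nth_1_strict_mono:
  assumes "a > 0" "b1 > 0" "b1 < b2"
  shows "fps_nth (logder a b1) (Suc 0) < fps_nth (logder a b2) (Suc 0)"
proof -
  have "b1 / (a + b1 + 1) < b2 / (a + b2 + 1)"
    using assms by (simp add: field_simps add_strict_mono)
  hence "a * (b1 / (a + b1 + 1)) < a * (b2 / (a + b2 + 1))"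
    using assms by (intro mult_strict_left_mono)
  with assms show ?thesis by (simp add: logder_nth_1)
qed

text \<open>Differencing \<open>rec\<close> leaves (b2 - b1)(v_m - v_n), nonnegative because v is
  nonincreasing, and products of E_i with increments of s = u + v. These increments are nonpositive
  except s_1 - s_0 = s_1, whose contribution E_m s_1 is absorbed by (m + a + b1) E_m.\<close>

lemma logder_nth_mono:
  assumes "a > 0" "b1 > 0" "b1 < b2"
  shows "fps_nth (logder a b1) n \<le> fps_nth (logder a b2) n"
proof -
  have b2: "b2 > 0" using assms by simp
  note pos1 = assms(1,2) and pos2 = assms(1) b2
  let ?u = "fps_nth (logder a b1)" and ?v = "fps_nth (logder a b2)"
  define E where "E n = ?v n - ?u n" for n
  define s where "s n = ?u n + ?v n" for n
  have rec: "(n + a + b1) * E n = (b2 - b1) * (a - ?v n) - (\<Sum>i=0..n. E i * s (n - i))"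
    if "n > 0" for n
  proof -
    let ?P = "\<lambda>f g. (\<Sum>i=0..n. f i * g (n - i) :: real)"
    \<comment> \<open>Commutativity of the convolution gives v v - u u = (v - u)(u + v), which is
      linear in \<open>E\<close> once s is given.\<close>
    have "?P ?u ?v = ?P ?v ?u"
      by (rule sum.reindex_bij_witness[of _ "\<lambda>i. n - i" "\<lambda>i. n - i"]) auto
    hence "?P E s = ?P ?v ?v - ?P ?u ?u"
      by (simp add: E_def s_def algebra_simps sum.distrib sum_subtractf)
    thus ?thesis
      using logder_rec[OF pos1 that] logder_rec[OF pos2 that]
      by (simp add: E_def algebra_simps)
  qed
  have "E n \<ge> 0"
  proof (induction n rule: less_induct)
    case (less n)
    consider "n = 0" | "n = 1" | m where "n = Suc m" "m > 0"
      by (cases n) auto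
    thus ?case
    proof cases
      case 2
      thus ?thesis using logder_nth_1_strict_mono[OF assms] by (simp add: E_def)
    next
      case 3
      have s_step: "s (Suc k) \<le> s k" if "k > 0" for k
        using logder_nth_Suc_le[OF pos1 that] logder_nth_Suc_le[OF pos2 that] by (simp add: s_def)
      have "(\<Sum>i=0..n. E i * s (n - i)) - (\<Sum>i=0..m. E i * s (m - i)) =
            (\<Sum>i=0..m. E i * (s (Suc (m - i)) - s (m - i)))"
        unfolding 3 by (rule convolution_Suc_diff) (simp add: s_def)
      also have "\<dots> = (\<Sum>i=0..<m. E i * (s (Suc (m - i)) - s (m - i))) + E m * s 1"
        by (simp add: s_def atLeast0AtMost lessThan_atLeast0 flip: lessThan_Suc_atMost)
      also have "(\<Sum>i=0..<m. E i * (s (Suc (m - i)) - s (m - i))) \<le> 0"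
        by (intro sum_nonpos mult_nonneg_nonpos less.IH) (auto simp: 3 s_step)
      finally have "(n + a + b1) * E n \<ge>
          (m + a + b1) * E m + (b2 - b1) * (?v m - ?v n) - E m * s 1"
        using rec[of n] rec[of m] 3 by (simp add: algebra_simps)
      moreover have "(b2 - b1) * (?v m - ?v n) \<ge> 0"
        using assms logder_nth_Suc_le[OF pos2 3(2)] 3 by (intro mult_nonneg_nonneg) auto
      moreover have "(m + a + b1 - s 1) * E m \<ge> 0"
      proof (intro mult_nonneg_nonneg less.IH)
        \<comment> \<open>Here u_1 < b1 and v_1 < a, hence s_1 < a + b1.\<close>
        show "0 \<le> m + a + b1 - s 1"
          using logder_nth_1_less[OF pos1] logder_nth_1_less[OF pos2] by (simp add: s_def)
      qed (use 3 in auto)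
      ultimately have "(n + a + b1) * E n \<ge> 0" by (simp add: algebra_simps)
      thus ?thesis using assms by (simp add: zero_le_mult_iff)
    qed (auto simp: E_def)
  qed
  thus ?thesis by (simp add: E_def)
qed

section \<open>Behaviour of the coefficients at infinity and the digamma function\<close>

lemma fps_conv_radius_ge_1:
  fixes f :: "real fps"
  assumes "\<And>n. \<bar>fps_nth f n\<bar> \<le> C"
  shows "fps_conv_radius f \<ge> 1"
  unfolding fps_conv_radius_def
proof (rule conv_radius_geI_ex')
  fix r :: real assume r: "0 < r" "ereal r < 1"
  show "summable (\<lambda>n. fps_nth f n * of_real r ^ n)"
  proof (rule summable_comparison_test')
    show "summable (\<lambda>n. C * r ^ n)"
      using r by (intro summable_mult summable_geometric) auto
    show "norm (fps_nth f n * of_real r ^ n) \<le> C * r ^ n" for n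
      using assms[of n] r by (simp add: abs_mult mult_right_mono)
  qed
qed

text \<open>(a + n)(b + n) = n (a + b + n) + a b. Hence n times the n-th coefficient grows, and is
  bounded below by its first value and above by its limit.\<close>

lemma n_zbal_nth_Suc:
  assumes "a > 0" "b > 0" "n > 0"
  shows "real (Suc n) * fps_nth (zbal a b) (Suc n) =
     (1 + a * b / (n * (a + b + n))) * (real n * fps_nth (zbal a b) n)"
proof -
  have "pochhammer (a + b) n > 0"
    using assms by (auto intro!: pochhammer_pos)
  have "real (Suc n) * fps_nth (zbal a b) (Suc n) = (a + n) * (b + n) / (a + b + n) * fps_nth (zbal a b) n"
    by (simp add: zbal_nth pochhammer_rec' mult_ac)
  also have "(a + n) * (b + n) / (a + b + n) = (1 + a * b / (n * (a + b + n))) * real n"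
    using assms add_pos_pos[of "a + b" "real n"] by (simp add: divide_simps) (simp add: algebra_simps)
  finally show ?thesis by simp
qed

text \<open>In the quotient of three \<open>Gamma_series\<close> the powers n^a, n^b and n^(a+b)
  cancel, leaving exactly n + 1 times the coefficient of index n + 1.\<close>

lemma n_zbal_nth_tendsto:
  assumes "a > 0" "b > 0"
  shows "(\<lambda>n. real n * fps_nth (zbal a b) n) \<longlonglongrightarrow> 1 / Beta a b"
proof -
  have nz: "Gamma a \<noteq> 0" "Gamma b \<noteq> 0" "Gamma (a + b) \<noteq> 0"
    using assms Gamma_real_pos[of a] Gamma_real_pos[of b] Gamma_real_pos[of "a + b"] by linarith+
  have "(\<lambda>n. Gamma_series (a + b) n / (Gamma_series a n * Gamma_series b n)) \<longlonglongrightarrow>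
      Gamma (a + b) / (Gamma a * Gamma b)"
    by (intro tendsto_intros Gamma_series_LIMSEQ) (use nz in auto)
  moreover have "eventually (\<lambda>n. Gamma_series (a + b) n / (Gamma_series a n * Gamma_series b n) =
      real (Suc n) * fps_nth (zbal a b) (Suc n)) sequentially"
    using eventually_gt_at_top[of 0]
  proof eventually_elim
    case (elim n)
    have "pochhammer (a + b) (n + 1) > 0" "pochhammer a (n + 1) > 0" "pochhammer b (n + 1) > 0"
      using assms by (auto intro!: pochhammer_pos simp del: pochhammer_Suc)
    moreover have "fact (Suc n) = real (Suc n) * fact n" by simp
    ultimately show ?case
      by (simp add: Gamma_series_def zbal_nth exp_add ring_distribs del: fact_Suc of_nat_Suc)
  qed
  ultimately have "(\<lambda>n. real (Suc n) * fps_nth (zbal a b) (Suc n)) \<longlonglongrightarrow>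
      Gamma (a + b) / (Gamma a * Gamma b)"
    by (rule Lim_transform_eventually)
  hence "(\<lambda>n. real n * fps_nth (zbal a b) n) \<longlonglongrightarrow> Gamma (a + b) / (Gamma a * Gamma b)"
    by (rule LIMSEQ_imp_Suc)
  thus ?thesis by (simp add: Beta_def)
qed

lemma n_zbal_nth_bounds:
  assumes "a > 0" "b > 0" "n > 0"
  shows "a * b / (a + b) \<le> real n * fps_nth (zbal a b) n"
    and "real n * fps_nth (zbal a b) n \<le> 1 / Beta a b"
proof -
  define t where "t n = real (Suc n) * fps_nth (zbal a b) (Suc n)" for n
  have mono: "incseq t"
  proof (rule incseq_SucI)
    fix n
    have "t n \<ge> 0" using zbal_pos[OF assms(1,2), of "Suc n"] by (simp add: t_def)
    moreover have "a * b / (Suc n * (a + b + Suc n)) \<ge> 0" using assms by simp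
    ultimately have "a * b / (Suc n * (a + b + Suc n)) * t n \<ge> 0"
      by (rule mult_nonneg_nonneg[rotated])
    thus "t n \<le> t (Suc n)"
      using n_zbal_nth_Suc[OF assms(1,2), of "Suc n"]
      by (simp add: t_def[symmetric] distrib_right del: of_nat_Suc)
  qed
  obtain m where m: "n = Suc m" using assms(3) by (cases n) auto
  have "t 0 \<le> t m" using mono by (simp add: incseq_def)
  thus "a * b / (a + b) \<le> real n * fps_nth (zbal a b) n"
    by (simp add: t_def m zbal_nth)
  have "t \<longlonglongrightarrow> 1 / Beta a b"
    using n_zbal_nth_tendsto[OF assms(1,2)]
    unfolding t_def by (rule LIMSEQ_Suc)
  with mono have "t m \<le> 1 / Beta a b" by (rule incseq_le)
  thus "real n * fps_nth (zbal a b) n \<le> 1 / Beta a b"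
    by (simp add: t_def m)
qed

lemma Beta_real_pos: "a > 0 \<Longrightarrow> b > 0 \<Longrightarrow> Beta a b > (0::real)"
  by (simp add: Beta_def)

lemma zbal_nth_le:
  assumes "a > 0" "b > 0" "n > 0"
  shows "fps_nth (zbal a b) n \<le> (1 / Beta a b) / n"
  using n_zbal_nth_bounds(2)[OF assms] assms(3)
  by (subst pos_le_divide_eq) (simp_all add: mult.commute)

lemma zbal1_nth_zbal:
  assumes "a > 0" "b > 0"
  shows "fps_nth (zbal1 a b) n = (a + b) / (a + b + n) * fps_nth (zbal a b) n"
  using zbal_nth_zbal1[OF assms, of n] assms by (simp add: field_simps)

lemma zbal1_nth_le:
  assumes "a > 0" "b > 0" "n > 0"
  shows "fps_nth (zbal1 a b) n \<le> ((a + b) / Beta a b) / n\<^sup>2"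
proof -
  have "fps_nth (zbal1 a b) n \<le> (a + b) / n * ((1 / Beta a b) / n)"
    unfolding zbal1_nth_zbal[OF assms(1,2)] using assms zbal_pos[OF assms(1,2), of n]
    by (intro mult_mono zbal_nth_le divide_left_mono) auto
  thus ?thesis by (simp add: power2_eq_square mult_ac)
qed

lemma zbal1_nth_le_zbal:
  assumes "a > 0" "b > 0"
  shows "fps_nth (zbal1 a b) n \<le> fps_nth (zbal a b) n"
  unfolding zbal1_nth_zbal[OF assms] using zbal_pos[OF assms, of n] assms
  by (intro mult_left_le_one_le) auto

lemma zbal_nth_le_max:
  assumes "a > 0" "b > 0"
  shows "fps_nth (zbal a b) n \<le> max 1 (1 / Beta a b)"
proof (cases "n = 0")
  case False
  have "fps_nth (zbal a b) n \<le> real n * fps_nth (zbal a b) n"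
    using zbal_pos[OF assms, of n] False by (intro mult_le_cancel_right1[THEN iffD2]) auto
  also have "\<dots> \<le> 1 / Beta a b" using n_zbal_nth_bounds(2)[OF assms] False by simp
  finally show ?thesis by simp
qed auto

lemma zbal_conv_radius:
  assumes "a > 0" "b > 0"
  shows "fps_conv_radius (zbal a b) \<ge> 1"
  by (rule fps_conv_radius_ge_1[of _ "max 1 (1 / Beta a b)"])
    (use zbal_nth_le_max[OF assms] zbal_pos[OF assms] in \<open>simp only: abs_of_pos\<close>)

lemma zbal1_conv_radius:
  assumes "a > 0" "b > 0"
  shows "fps_conv_radius (zbal1 a b) \<ge> 1"
  by (rule fps_conv_radius_ge_1[of _ "max 1 (1 / Beta a b)"])
    (use order.trans[OF zbal1_nth_le_zbal zbal_nth_le_max, OF assms assms] zbal1_pos[OF assms]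
      in \<open>simp only: abs_of_pos\<close>)

lemma logder_conv_radius:
  assumes "a > 0" "b > 0"
  shows "fps_conv_radius (logder a b) \<ge> 1"
  by (rule fps_conv_radius_ge_1[of _ a])
    (use logder_nth_nonneg[OF assms] logder_nth_le[OF assms] in auto)

text \<open>By \<open>zbal1_nth_Suc\<close> the sum up to n is a rational multiple of the next
  coefficient, so the induction closes. The closed form yields both the value G(1) and Euler's
  transformation in \<open>hyp2F1_euler\<close>.\<close>

lemma sum_zbal1:
  assumes "a > 0" "b > 0"
  shows "(\<Sum>i\<le>n. fps_nth (zbal1 a b) i) = (a + n) * (b + n) / (a * b) * fps_nth (zbal1 a b) n"
proof (induction n)
  case 0
  show ?case using assms by simp
next
  case (Suc n)
  have "(\<Sum>i\<le>Suc n. fps_nth (zbal1 a b) i) =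
      ((1 + real n) * (1 + real n + a + b) * fps_nth (zbal1 a b) (Suc n)) / (a * b) +
      fps_nth (zbal1 a b) (Suc n)"
    unfolding zbal1_nth_Suc[OF assms] using Suc by simp
  also have "\<dots> = (a + Suc n) * (b + Suc n) / (a * b) * fps_nth (zbal1 a b) (Suc n)"
    using assms by (simp add: field_simps)
  finally show ?case .
qed

text \<open>Gauss's value Gamma(a+b+1)/(Gamma(a+1) Gamma(b+1)) of F(a,b;a+b+1;1), read off the
  closed partial sums and the limit of n times the coefficients of F.\<close>

lemma zbal1_sums:
  assumes "a > 0" "b > 0"
  shows "fps_nth (zbal1 a b) sums ((a + b) / (a * b * Beta a b))"
  unfolding sums_def_le
proof -
  have "(\<lambda>n. (a + real n) * (b + real n) / (real n * (a + b + real n))) \<longlonglongrightarrow> 1"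
    by real_asymp
  from tendsto_mult[OF tendsto_mult[OF this tendsto_const[of "(a + b) / (a * b)"]] n_zbal_nth_tendsto[OF assms]]
  have "(\<lambda>n. (a + real n) * (b + real n) / (real n * (a + b + real n)) * ((a + b) / (a * b)) *
      (real n * fps_nth (zbal a b) n)) \<longlonglongrightarrow> (a + b) / (a * b * Beta a b)"
    by (simp add: mult_ac)
  thus "(\<lambda>n. \<Sum>i\<le>n. fps_nth (zbal1 a b) i) \<longlonglongrightarrow> (a + b) / (a * b * Beta a b)"
  proof (rule Lim_transform_eventually)
    show "\<forall>\<^sub>F n in sequentially. (a + real n) * (b + real n) / (real n * (a + b + real n)) * ((a + b) / (a * b)) *
      (real n * fps_nth (zbal a b) n) = (\<Sum>i\<le>n. fps_nth (zbal1 a b) i)"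
      using eventually_gt_at_top[of 0]
    proof eventually_elim
      case (elim n)
      show ?case
        by (subst sum_zbal1[OF assms]) (use elim in \<open>simp add: zbal1_nth_zbal[OF assms] mult_ac\<close>)
    qed
  qed
qed

text \<open>Both terms are multiples of one coefficient of G, with factors proportional to a + b + n
  and b + n, so n drops out of the difference. The shift from b to b + 1 thus costs a convergent
  series, whose sum 1/b matches psi(b + 1) - psi(b).\<close>

lemma Beta_zbal_nth_diff:
  assumes "a > 0" "b > 0"
  shows "Beta a b * fps_nth (zbal a b) n - Beta a (b + 1) * fps_nth (zbal a (b + 1)) n =
         a * Beta a b / (a + b) * fps_nth (zbal1 a b) n"
proof -
  have "pochhammer (b + 1) n = (b + n) / b * pochhammer b n"
    using pochhammer_rec[of b n] pochhammer_rec'[of b n] assms by (simp add: field_simps)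
  hence 1: "fps_nth (zbal a (b + 1)) n = (b + n) / b * fps_nth (zbal1 a b) n"
    by (simp add: zbal_nth zbal1_nth add.assoc)
  have 2: "fps_nth (zbal a b) n = (a + b + n) / (a + b) * fps_nth (zbal1 a b) n"
    using zbal_nth_zbal1[OF assms, of n] assms by (simp add: field_simps)
  have 3: "Beta a (b + 1) = b * Beta a b / (a + b)"
    proof -
    have "b \<notin> \<int>\<^sub>\<le>\<^sub>0" using assms by (auto elim!: nonpos_Ints_cases)
    from Beta_plus1_right[OF this, of a] assms show ?thesis by (simp add: field_simps)
  qed
  show ?thesis unfolding 1 2 3 using assms by (simp add: divide_simps) (simp add: algebra_simps)
qed

lemma Beta_zbal_diff_sums:
  assumes "a > 0" "b > 0"
  shows "(\<lambda>n. Beta a b * fps_nth (zbal a b) n - Beta a (b + 1) * fps_nth (zbal a (b + 1)) n) sums (1 / b)"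
proof -
  have "Beta a b \<noteq> 0" using Beta_real_pos[OF assms] by simp
  thus ?thesis
    unfolding Beta_zbal_nth_diff[OF assms]
    using sums_mult[OF zbal1_sums[OF assms], of "a * Beta a b / (a + b)"] assms by simp
qed

lemma Beta_antimono_right:
  assumes "a > 0" "0 < x" "x \<le> (y::real)"
  shows "Beta a y \<le> Beta a x"
proof (rule DERIV_nonpos_imp_nonincreasing[OF assms(3)])
  fix z assume "x \<le> z" "z \<le> y"
  with assms have z: "z > 0" by simp
  hence "(Beta a has_real_derivative Beta a z * (Digamma z - Digamma (a + z))) (at z)"
    using assms by (intro has_field_derivative_Beta2) (auto elim!: nonpos_Ints_cases)
  moreover have "Beta a z * (Digamma z - Digamma (a + z)) \<le> 0"
    using assms z Digamma_real_mono[of z "a + z"] Beta_real_pos[of a z]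
    by (intro mult_nonneg_nonpos) auto
  ultimately show "\<exists>D. (Beta a has_real_derivative D) (at z) \<and> D \<le> 0" by blast
qed

text \<open>On the right b enters only through B(a, b + n), so monotonicity in b is that of the beta
  function.\<close>

lemma Beta_zbal_nth:
  assumes "a > 0" "b > 0"
  shows "Beta a b * fps_nth (zbal a b) n = pochhammer a n / fact n * Beta a (b + n)"
proof -
  have "Beta a (b + n) = Beta a b * pochhammer b n / pochhammer (a + b) n"
  proof (induction n)
    case (Suc n)
    have "(a + (b + n)) * Beta a (b + n + 1) = (b + n) * Beta a (b + n)"
      using assms by (intro Beta_plus1_right) (auto elim!: nonpos_Ints_cases)
    hence "Beta a (b + Suc n) = (b + n) / (a + b + n) * Beta a (b + n)"
      using assms by (simp add: field_simps add_ac)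
    thus ?case using Suc by (simp add: pochhammer_rec' mult_ac)
  qed auto
  thus ?thesis by (simp add: zbal_nth mult_ac)
qed

lemma Beta_zbal_nth_antimono:
  assumes "a > 0" "0 < x" "x \<le> y"
  shows "Beta a y * fps_nth (zbal a y) n \<le> Beta a x * fps_nth (zbal a x) n"
proof -
  have "Beta a (y + n) \<le> Beta a (x + n)" using assms by (intro Beta_antimono_right) auto
  moreover have "pochhammer a n / fact n \<ge> 0" using pochhammer_pos[OF assms(1), of n] by simp
  ultimately show ?thesis
    using assms by (simp only: Beta_zbal_nth order.strict_trans2[OF assms(2,3)] mult_left_mono)
qed

text \<open>Integer shifts telescope into series known to converge. For x \<le> y some shift x + m
  lies beyond y and dominates: t_n(x) - t_n(y) is between 0 and t_n(x) - t_n(x + m).\<close>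

lemma Beta_zbal_diff_summable:
  assumes "a > 0" "x > 0" "y > 0"
  shows "summable (\<lambda>n. Beta a x * fps_nth (zbal a x) n - Beta a y * fps_nth (zbal a y) n)"
proof -
  define t where "t z n = Beta a z * fps_nth (zbal a z) n" for z n
  have shift: "summable (\<lambda>n. t z n - t (z + real m) n)" if "z > 0" for z m
  proof (induction m)
    case (Suc m)
    have "summable (\<lambda>n. t (z + m) n - t (z + m + 1) n)"
      unfolding t_def using Beta_zbal_diff_sums[of a "z + m"] assms that by (auto dest: sums_summable)
    from summable_add[OF Suc this] show ?case by (simp add: add_ac)
  qed auto
  have *: "summable (\<lambda>n. t x n - t y n)" if "0 < x" "x \<le> y" for x y
  proof -
    obtain m where m: "y \<le> x + real m"
      using real_arch_simple[of "y - x"] by (auto simp: algebra_simps)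
    show ?thesis
    proof (rule summable_comparison_test'[OF shift[OF that(1), of m]])
      fix n
      have "t y n \<le> t x n" "t (x + m) n \<le> t y n"
        unfolding t_def using m that assms by (auto intro!: Beta_zbal_nth_antimono)
      thus "norm (t x n - t y n) \<le> t x n - t (x + m) n" by simp
    qed
  qed
  have "summable (\<lambda>n. t x n - t y n)"
  proof (cases "x \<le> y")
    case False
    with *[of y x] assms have "summable (\<lambda>n. - (t y n - t x n))" by (subst summable_minus_iff) auto
    thus ?thesis by simp
  qed (use * assms in auto)
  thus ?thesis by (simp add: t_def)
qed

text \<open>p - q has period 1, so the increments from x to y may be compared from x + n to y + n.
  There monotonicity squeezes each of them between 0 and the increment over m unit steps, which is
  at most m/(x + n) and tends to 0.\<close>

lemma periodic_difference_unique:
  fixes p q :: "real \<Rightarrow> real"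
  assumes "\<And>x y. 0 < x \<Longrightarrow> x \<le> y \<Longrightarrow> p x \<le> p y" "\<And>x. x > 0 \<Longrightarrow> p (x + 1) = p x + 1 / x"
    and "\<And>x y. 0 < x \<Longrightarrow> x \<le> y \<Longrightarrow> q x \<le> q y" "\<And>x. x > 0 \<Longrightarrow> q (x + 1) = q x + 1 / x"
    and "0 < x" "x \<le> y"
  shows "p y - p x = q y - q x"
proof -
  obtain m where m: "y \<le> x + real m"
    using real_arch_simple[of "y - x"] by (auto simp: algebra_simps)
  have shift: "p (z + real n) = p z + (\<Sum>i<n. 1 / (z + real i))" if "z > 0"
    and "\<And>x::real. x > 0 \<Longrightarrow> p (x + 1) = p x + 1 / x" for p :: "real \<Rightarrow> real" and z :: real and n :: nat
  proof (induction n)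
    case (Suc n)
    have "p (z + Suc n) = p (z + n) + 1 / (z + n)"
      using that(2)[of "z + n"] that(1) by (simp add: add_ac)
    thus ?case using Suc by simp
  qed auto
  have range: "0 \<le> p (y + real n) - p (x + real n)"
      "p (y + real n) - p (x + real n) \<le> real m / (x + real n)"
    if mono: "\<And>x y. 0 < x \<Longrightarrow> x \<le> y \<Longrightarrow> p x \<le> p y"
      and rec: "\<And>x. x > 0 \<Longrightarrow> p (x + 1) = p x + 1 / x" for p :: "real \<Rightarrow> real" and n :: nat
  proof -
    show "0 \<le> p (y + real n) - p (x + real n)" using mono[of "x + real n" "y + real n"] assms by simp
    have "p (y + real n) \<le> p (x + real n + real m)" using assms m by (intro mono) auto
    also have "\<dots> = p (x + real n) + (\<Sum>i<m. 1 / (x + real n + real i))" using assms by (intro shift rec) auto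
    also have "(\<Sum>i<m. 1 / (x + real n + real i)) \<le> (\<Sum>i<m. 1 / (x + real n))"
      using assms by (intro sum_mono divide_left_mono) auto
    finally show "p (y + real n) - p (x + real n) \<le> real m / (x + real n)" by simp
  qed
  have eq: "\<bar>(p y - p x) - (q y - q x)\<bar> \<le> real m / (x + real n)" for n :: nat
    using range[of p n] range[of q n] shift[of x p n] shift[of x q n] shift[of y p n] shift[of y q n] assms
    by (simp add: abs_le_iff)
  have "(\<lambda>n. real m / (x + real n)) \<longlonglongrightarrow> 0" by real_asymp
  hence "\<bar>(p y - p x) - (q y - q x)\<bar> \<le> 0"
    by (rule tendsto_lowerbound) (use eq in auto)
  thus ?thesis by simp
qed

lemma suminf_Beta_zbal_diff:
  assumes "a > 0" "0 < x" "x \<le> y"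
  shows "(\<Sum>n. Beta a x * fps_nth (zbal a x) n - Beta a y * fps_nth (zbal a y) n) = Digamma y - Digamma x"
proof -
  define t where "t z n = Beta a z * fps_nth (zbal a z) n" for z n
  \<comment> \<open>The series of \<open>t z\<close> alone diverges, its terms being asymptotic to
    1/n; subtracting it from that of \<open>t 1\<close> fixes a base point.\<close>
  define S where "S z = (\<Sum>n. t 1 n - t z n)" for z
  have summ: "summable (\<lambda>n. t x n - t y n)" if "x > 0" "y > 0" for x y
    unfolding t_def using assms that by (intro Beta_zbal_diff_summable)
  have S_diff: "S y - S x = (\<Sum>n. t x n - t y n)" if "x > 0" "y > 0" for x y
    unfolding S_def using that by (subst suminf_diff) (auto intro!: summ)
  have "S y - S x = Digamma y - Digamma x"
  proof (rule periodic_difference_unique)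
    fix x y :: real assume "0 < x" "x \<le> y"
    hence "S y - S x \<ge> 0"
      unfolding S_diff[OF \<open>0 < x\<close> order.strict_trans2[OF \<open>0 < x\<close> \<open>x \<le> y\<close>]]
      using assms(1) by (intro suminf_nonneg summ) (auto simp: t_def Beta_zbal_nth_antimono)
    thus "S x \<le> S y" by simp
  next
    fix x :: real assume x: "0 < x"
    have "S (x + 1) - S x = 1 / x"
      using x assms Beta_zbal_diff_sums[of a x] by (subst S_diff) (auto simp: t_def sums_iff)
    thus "S (x + 1) = S x + 1 / x" by simp
  qed (use assms in \<open>auto simp: Digamma_real_mono Digamma_plus1\<close>)
  thus ?thesis using S_diff[of x y] assms by (simp add: t_def)
qed

section \<open>Behaviour at the endpoint 1\<close>

lemma eventually_unit_at_left_1: "eventually (\<lambda>r::real. r \<in> {0<..<1}) (at_left 1)"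
  by (rule eventually_at_left_real) simp

lemma suminf_power_tendsto_at_left_1:
  fixes u :: "nat \<Rightarrow> real"
  assumes "summable (\<lambda>n. \<bar>u n\<bar>)"
  shows "((\<lambda>r. \<Sum>n. u n * r ^ n) \<longlongrightarrow> suminf u) (at_left 1)"
proof -
  have "uniform_limit {0..1} (\<lambda>n r. \<Sum>i<n. u i * r ^ i) (\<lambda>r. \<Sum>i. u i * r ^ i) sequentially"
  proof (rule Weierstrass_m_test[OF _ assms])
    fix n and r :: real assume "r \<in> {0..1}"
    thus "norm (u n * r ^ n) \<le> \<bar>u n\<bar>"
      by (simp add: abs_mult mult_left_le power_le_one)
  qed
  hence "continuous_on {0..1} (\<lambda>r. \<Sum>i. u i * r ^ i)"
    by (rule uniform_limit_theorem[rotated]) (auto intro!: always_eventually continuous_intros)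
  hence "((\<lambda>r. \<Sum>i. u i * r ^ i) \<longlongrightarrow> (\<Sum>i. u i * 1 ^ i)) (at 1 within {0..1})"
    unfolding continuous_on_def by (rule bspec) simp
  thus ?thesis
    by (simp add: at_within_Icc_at_left)
qed

lemma less_fps_conv_radius:
  fixes f :: "real fps" and r :: real
  assumes "fps_conv_radius f \<ge> 1" "\<bar>r\<bar> < 1"
  shows "ereal (norm r) < fps_conv_radius f"
  by (rule less_le_trans[OF _ assms(1)]) (use assms(2) in \<open>simp add: one_ereal_def\<close>)

text \<open>The term at n = 0 is 1/0 = 0, so the series may start there.\<close>

lemma ln_one_minus_sums:
  fixes r :: real
  assumes "0 < r" "r < 1"
  shows "(\<lambda>n. r ^ n / n) sums (- ln (1 - r))"
proof -
  have "(\<lambda>n. - ((- (- r)) ^ n) / real n) sums ln (1 + - r)"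
    by (rule ln_series') (use assms in auto)
  from sums_minus[OF this] show ?thesis by simp
qed

lemma abs_suminf_power_le_ln:
  fixes u :: "nat \<Rightarrow> real"
  assumes u: "\<And>n. n > 0 \<Longrightarrow> \<bar>u n\<bar> \<le> C / n" and r: "0 < r" "r < 1"
  shows "\<bar>\<Sum>n. u n * r ^ n\<bar> \<le> \<bar>u 0\<bar> - C * ln (1 - r)"
proof -
  define v where "v n = (if n = 0 then \<bar>u 0\<bar> else 0) + C * (r ^ n / n)" for n
  have v: "v sums (\<bar>u 0\<bar> + C * (- ln (1 - r)))"
    unfolding v_def by (intro sums_add sums_mult ln_one_minus_sums r) (use sums_single[of 0 "\<lambda>_. \<bar>u 0\<bar>"] in simp)
  have le: "norm (u n * r ^ n) \<le> v n" for n
    using mult_right_mono[OF u[of n], of "r ^ n"] r by (cases "n = 0") (auto simp: v_def abs_mult)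
  have "summable (\<lambda>n. norm (u n * r ^ n))"
    by (rule summable_comparison_test'[OF sums_summable[OF v]]) (use le in auto)
  hence "\<bar>\<Sum>n. u n * r ^ n\<bar> \<le> (\<Sum>n. norm (u n * r ^ n))"
    using summable_norm by fastforce
  also have "\<dots> \<le> (\<Sum>n. v n)"
    by (intro suminf_le le sums_summable[OF v]) fact
  also have "\<dots> = \<bar>u 0\<bar> - C * ln (1 - r)" using v by (simp add: sums_iff)
  finally show ?thesis .
qed

text \<open>1 - r^n is at most 1 and at most n (1 - r), hence at most the square root of their
  product. The bound 1 gives no decay and n (1 - r) would leave the divergent sum of 1/n; the
  geometric mean leaves n^(-3/2) and a factor sqrt(1 - r), which beats a logarithm.\<close>

lemma suminf_power_diff_le_sqrt:
  fixes v :: "nat \<Rightarrow> real"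
  assumes v: "\<And>n. n > 0 \<Longrightarrow> \<bar>v n\<bar> \<le> D / (real n)\<^sup>2" and r: "0 < r" "r < 1"
  shows "\<bar>suminf v - (\<Sum>n. v n * r ^ n)\<bar> \<le> D * (\<Sum>n. real n powr (- (3 / 2))) * sqrt (1 - r)"
proof -
  have D: "D \<ge> 0" using v[of 1] by simp
  have sum: "summable (\<lambda>n. real n powr (- (3 / 2)))"
    by (simp add: summable_real_powr_iff)
  have one_minus: "0 \<le> 1 - r ^ n" "1 - r ^ n \<le> sqrt (real n * (1 - r))" for n
  proof -
    have "1 + real n * (r - 1) \<le> (1 + (r - 1)) ^ n"
      using r by (intro Bernoulli_inequality) auto
    hence x: "1 - r ^ n \<le> real n * (1 - r)" by (simp add: algebra_simps)
    show x0: "0 \<le> 1 - r ^ n" using r by (simp add: power_le_one)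
    have "(1 - r ^ n) * (1 - r ^ n) \<le> 1 * (1 - r ^ n)"
      using x0 r by (intro mult_right_mono) auto
    hence "(1 - r ^ n)\<^sup>2 \<le> real n * (1 - r)"
      unfolding power2_eq_square mult_1 using x by (rule order.trans)
    thus "1 - r ^ n \<le> sqrt (real n * (1 - r))" by (rule real_le_rsqrt)
  qed
  have summ_v: "summable (\<lambda>n. \<bar>v n\<bar>)"
  proof (rule summable_comparison_test_ev)
    show "summable (\<lambda>n. D * real n powr (-2))"
      by (intro summable_mult) (simp add: summable_real_powr_iff)
    show "\<forall>\<^sub>F n in sequentially. norm \<bar>v n\<bar> \<le> D * real n powr (-2)"
      using eventually_gt_at_top[of 0]
      by eventually_elim (use v in \<open>simp add: powr_minus divide_inverse\<close>)
  qed
  have summ_vr: "summable (\<lambda>n. v n * r ^ n)"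
    by (rule summable_comparison_test'[OF summ_v])
      (use r in \<open>simp add: abs_mult mult_left_le power_le_one\<close>)
  have le: "norm (v n * (1 - r ^ n)) \<le> D * real n powr (- (3 / 2)) * sqrt (1 - r)" for n
  proof (cases "n = 0")
    case False
    have "norm (v n * (1 - r ^ n)) \<le> D / (real n)\<^sup>2 * sqrt (real n * (1 - r))"
      unfolding norm_mult using v[of n] one_minus[of n] False D
      by (intro mult_mono) auto
    also have "real n powr (- (3 / 2)) = sqrt (real n) / (real n)\<^sup>2"
    proof -
      have "real n powr (- (3 / 2)) = real n powr (1 / 2 - 2)" by simp
      also have "\<dots> = sqrt (real n) / (real n)\<^sup>2"
        using False by (subst powr_diff) (simp add: powr_half_sqrt)
      finally show ?thesis .
    qed
    hence "D / (real n)\<^sup>2 * sqrt (real n * (1 - r)) = D * real n powr (- (3 / 2)) * sqrt (1 - r)"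
      by (simp add: real_sqrt_mult)
    finally show ?thesis .
  qed auto
  have summ': "summable (\<lambda>n. D * real n powr (- (3 / 2)) * sqrt (1 - r))"
    by (intro summable_mult2 summable_mult sum)
  have summ_norm: "summable (\<lambda>n. norm (v n * (1 - r ^ n)))"
    by (rule summable_comparison_test'[OF summ']) (use le in simp)
  have "suminf v - (\<Sum>n. v n * r ^ n) = (\<Sum>n. v n * (1 - r ^ n))"
    using summable_rabs_cancel[OF summ_v] summ_vr by (simp add: suminf_diff algebra_simps)
  also have "\<bar>\<dots>\<bar> \<le> (\<Sum>n. norm (v n * (1 - r ^ n)))"
    using summable_norm[OF summ_norm] by simp
  also have "\<dots> \<le> (\<Sum>n. D * real n powr (- (3 / 2)) * sqrt (1 - r))"
    by (intro suminf_le le summ' summ_norm)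
  also have "\<dots> = D * (\<Sum>n. real n powr (- (3 / 2))) * sqrt (1 - r)"
    using sums_mult2[OF sums_mult[OF summable_sums[OF sum], of D], of "sqrt (1 - r)"]
    by (simp add: sums_iff)
  finally show ?thesis .
qed

lemma log_times_gap_tendsto_0:
  fixes u v :: "nat \<Rightarrow> real"
  assumes u: "\<And>n. n > 0 \<Longrightarrow> \<bar>u n\<bar> \<le> C / n" and v: "\<And>n. n > 0 \<Longrightarrow> \<bar>v n\<bar> \<le> D / (real n)\<^sup>2"
  shows "((\<lambda>r. (\<Sum>n. u n * r ^ n) * (suminf v - (\<Sum>n. v n * r ^ n))) \<longlongrightarrow> 0) (at_left 1)"
proof -
  define K where "K = D * (\<Sum>n. real n powr (- (3 / 2)))"
  show ?thesis
  proof (rule Lim_null_comparison)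
    have "((\<lambda>r::real. ln (1 - r) * sqrt (1 - r)) \<longlongrightarrow> 0) (at_left 1)"
      "((\<lambda>r::real. sqrt (1 - r)) \<longlongrightarrow> 0) (at_left 1)" by real_asymp+
    hence "((\<lambda>r::real. \<bar>u 0\<bar> * K * sqrt (1 - r) - C * K * (ln (1 - r) * sqrt (1 - r))) \<longlongrightarrow>
        \<bar>u 0\<bar> * K * 0 - C * K * 0) (at_left 1)"
      by (intro tendsto_intros)
    thus "((\<lambda>r. (\<bar>u 0\<bar> - C * ln (1 - r)) * (K * sqrt (1 - r))) \<longlongrightarrow> 0) (at_left 1)"
      by (simp add: algebra_simps)
    from eventually_unit_at_left_1 show "\<forall>\<^sub>F r in at_left 1. norm ((\<Sum>n. u n * r ^ n) * (suminf v - (\<Sum>n. v n * r ^ n))) \<le>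
        (\<bar>u 0\<bar> - C * ln (1 - r)) * (K * sqrt (1 - r))"
    proof eventually_elim
      case (elim r)
      have "norm (\<Sum>n. u n * r ^ n) \<le> \<bar>u 0\<bar> - C * ln (1 - r)"
        using abs_suminf_power_le_ln[OF u, of r] elim by simp
      moreover from this have "\<bar>u 0\<bar> - C * ln (1 - r) \<ge> 0" by (rule order.trans[OF norm_ge_zero])
      moreover have "norm (suminf v - (\<Sum>n. v n * r ^ n)) \<le> K * sqrt (1 - r)"
        using suminf_power_diff_le_sqrt[OF v, of r] elim by (simp add: K_def)
      ultimately show ?case unfolding norm_mult by (intro mult_mono) auto
    qed
  qed
qed

section \<open>F and G on (0,1) and their behaviour at 1\<close>

context
  fixes a b :: real
  assumes pos: "a > 0" "b > 0"
begin

lemma eval_zbal_sums: "\<bar>r\<bar> < 1 \<Longrightarrow> (\<lambda>n. fps_nth (zbal a b) n * r ^ n) sums eval_fps (zbal a b) r"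
  by (intro sums_eval_fps less_fps_conv_radius zbal_conv_radius pos)

lemma eval_zbal1_sums: "\<bar>r\<bar> < 1 \<Longrightarrow> (\<lambda>n. fps_nth (zbal1 a b) n * r ^ n) sums eval_fps (zbal1 a b) r"
  by (intro sums_eval_fps less_fps_conv_radius zbal1_conv_radius pos)

lemma eval_zbal_filterlim: "filterlim (eval_fps (zbal a b)) at_top (at_left 1)"
proof (rule filterlim_at_top_mono)
  have "a * b / (a + b) > 0" using pos by simp
  moreover have "filterlim (\<lambda>r::real. - ln (1 - r)) at_top (at_left 1)" by real_asymp
  ultimately show "filterlim (\<lambda>r. a * b / (a + b) * (- ln (1 - r))) at_top (at_left 1)"
    by (intro filterlim_tendsto_pos_mult_at_top[OF tendsto_const])
  from eventually_unit_at_left_1 show "\<forall>\<^sub>F r in at_left 1. a * b / (a + b) * (- ln (1 - r)) \<le> eval_fps (zbal a b) r"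
  proof eventually_elim
    case (elim r)
    hence r: "0 < r" "r < 1" by auto
    show ?case
    proof (rule sums_le[OF _ sums_mult[OF ln_one_minus_sums[OF r]] eval_zbal_sums])
      show "a * b / (a + b) * (r ^ n / real n) \<le> fps_nth (zbal a b) n * r ^ n" for n
      proof (cases "n = 0")
        case False
        have "a * b / (a + b) / n \<le> fps_nth (zbal a b) n"
          using n_zbal_nth_bounds(1)[OF pos] False by (subst pos_divide_le_eq) (auto simp: mult.commute)
        from mult_right_mono[OF this, of "r ^ n"] show ?thesis using r by simp
      qed auto
    qed (use r in auto)
  qed
qed

lemma eval_zbal_gt_1:
  assumes "0 < r" "r < 1"
  shows "eval_fps (zbal a b) r > 1"
proof -
  have "\<bar>r\<bar> < 1" using assms by simp
  from sums_iff[THEN iffD1, OF eval_zbal_sums[OF this]]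
  have "(\<Sum>n<2. fps_nth (zbal a b) n * r ^ n) \<le> eval_fps (zbal a b) r"
    using sum_le_suminf[of "\<lambda>n. fps_nth (zbal a b) n * r ^ n" "{..<2}"]
      zbal_pos[OF pos, THEN less_imp_le] assms by simp
  moreover have "(\<Sum>n<2. fps_nth (zbal a b) n * r ^ n) > 1"
    using zbal_pos[OF pos, of 1] assms by (simp add: numeral_2_eq_2)
  ultimately show ?thesis by linarith
qed

lemma eval_zbal1_ge_1:
  assumes "0 \<le> r" "r < 1"
  shows "eval_fps (zbal1 a b) r \<ge> 1"
proof -
  have "\<bar>r\<bar> < 1" using assms by simp
  from sums_iff[THEN iffD1, OF eval_zbal1_sums[OF this]]
  have "(\<Sum>n<1. fps_nth (zbal1 a b) n * r ^ n) \<le> eval_fps (zbal1 a b) r"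
    using sum_le_suminf[of "\<lambda>n. fps_nth (zbal1 a b) n * r ^ n" "{..<1}"]
      zbal1_pos[OF pos, THEN less_imp_le] assms by simp
  thus ?thesis by simp
qed

lemma zbal1_abs_summable: "summable (\<lambda>n. \<bar>fps_nth (zbal1 a b) n\<bar>)"
  using zbal1_sums[OF pos] zbal1_pos[OF pos] by (simp add: abs_of_pos sums_iff)

lemma eval_zbal1_tendsto: "(eval_fps (zbal1 a b) \<longlongrightarrow> (a + b) / (a * b * Beta a b)) (at_left 1)"
  using suminf_power_tendsto_at_left_1[OF zbal1_abs_summable] zbal1_sums[OF pos]
  by (simp add: eval_fps_def[abs_def] sums_iff)

end

text \<open>Lets \<open>f4_tendsto\<close> replace G by its value at 1 inside products with the
  divergent F.\<close>

lemma zbal_zbal1_gap_tendsto: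
  assumes "a > 0" "b > 0" "b' > 0"
  shows "((\<lambda>r. eval_fps (zbal a b) r * ((a + b') / (a * b' * Beta a b') - eval_fps (zbal1 a b') r)) \<longlongrightarrow> 0) (at_left 1)"
proof -
  have "suminf (fps_nth (zbal1 a b')) = (a + b') / (a * b' * Beta a b')"
    using zbal1_sums[of a b'] assms by (simp add: sums_iff)
  thus ?thesis
    using log_times_gap_tendsto_0[of "fps_nth (zbal a b)" "1 / Beta a b" "fps_nth (zbal1 a b')" "(a + b') / Beta a b'"]
      zbal_nth_le[of a b] zbal1_nth_le[of a b'] zbal_pos[of a b] zbal1_pos[of a b'] assms
    by (simp add: eval_fps_def abs_of_pos)
qed

lemma Beta_zbal_diff_tendsto:
  assumes "a > 0" "0 < x" "x \<le> y"
  shows "((\<lambda>r. Beta a x * eval_fps (zbal a x) r - Beta a y * eval_fps (zbal a y) r) \<longlongrightarrow>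
      Digamma y - Digamma x) (at_left 1)"
proof -
  have y: "y > 0" using assms by simp
  let ?t = "\<lambda>n. Beta a x * fps_nth (zbal a x) n - Beta a y * fps_nth (zbal a y) n"
  \<comment> \<open>The terms have one sign, so their summability is absolute and the series is
    continuous up to r = 1.\<close>
  have abs: "\<bar>?t n\<bar> = ?t n" for n using Beta_zbal_nth_antimono[OF assms] by simp
  have "((\<lambda>r. \<Sum>n. ?t n * r ^ n) \<longlongrightarrow> Digamma y - Digamma x) (at_left 1)"
    using suminf_power_tendsto_at_left_1[of ?t] Beta_zbal_diff_summable[OF assms(1,2) y]
    unfolding abs suminf_Beta_zbal_diff[OF assms] by blast
  moreover from eventually_unit_at_left_1 have "\<forall>\<^sub>F r in at_left 1. (\<Sum>n. ?t n * r ^ n) = Beta a x * eval_fps (zbal a x) r - Beta a y * eval_fps (zbal a y) r"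
  proof eventually_elim
    case (elim r)
    hence "\<bar>r\<bar> < 1" by simp
    from sums_diff[OF sums_mult[OF eval_zbal_sums[OF assms(1,2) this]] sums_mult[OF eval_zbal_sums[OF assms(1) y this]]]
    have "(\<lambda>n. Beta a x * (fps_nth (zbal a x) n * r ^ n) - Beta a y * (fps_nth (zbal a y) n * r ^ n)) sums
        (Beta a x * eval_fps (zbal a x) r - Beta a y * eval_fps (zbal a y) r)" .
    thus ?case by (simp add: sums_iff algebra_simps)
  qed
  ultimately show ?thesis by (rule Lim_transform_eventually)
qed

section \<open>The power series of f4\<close>

text \<open>F_2/G_2 is entered as 1 + w_2/c_2 because signs and size of the coefficients of w_2 are
  under control.\<close>

definition f4_fps :: "real \<Rightarrow> real \<Rightarrow> real \<Rightarrow> real fps" where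
  "f4_fps a b1 b2 = fps_const (alpha_bar a b1 b2) * zbal a b1 -
     zbal1 a b1 * (1 + fps_const (1 / (a + b2)) * logder a b2)"

text \<open>With q = \<alpha>/c_1 and p = 1/c_2 the series is G_1 (q (c_1 + w_1) - (1 + p w_2)). The
  value of \<alpha> enters through q b1 = p b2: the sources of the two Riccati equations then
  cancel, and w_2 - w_1 factors out of the rest.\<close>

lemma fps_theta_f4_fps:
  assumes "a > 0" "b1 > 0" "b2 > 0"
  shows "fps_theta (f4_fps a b1 b2) = zbal1 a b1 *
    ((1 + fps_const (1 / (a + b2)) * logder a b2) * (logder a b2 - logder a b1))"
proof -
  define G where "G = zbal1 a b1"
  define u where "u = logder a b1"
  define v where "v = logder a b2"
  define q where "q = fps_const (b2 / (b1 * (a + b2)))"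
  define p where "p = fps_const (1 / (a + b2))"
  have cs: "fps_const (alpha_bar a b1 b2) = q * fps_const (a + b1)"
      "fps_const (alpha_bar a b1 b2) * fps_const (1 / (a + b1)) = q"
      "p * fps_const (a + b2) = 1"
      "q * fps_const (a * b1) = p * fps_const (a * b2)"
  proof -
    have "a + b1 > 0" "a + b2 > 0" using assms by auto
    thus "fps_const (alpha_bar a b1 b2) = q * fps_const (a + b1)"
      "fps_const (alpha_bar a b1 b2) * fps_const (1 / (a + b1)) = q"
      "p * fps_const (a + b2) = 1"
      "q * fps_const (a * b1) = p * fps_const (a * b2)"
      using assms by (simp_all add: q_def p_def alpha_bar_def fps_const_mult
          del: fps_const_add times_divide_eq_left times_divide_eq_right)
        (simp_all add: divide_simps)
  qed
  have "fps_const (alpha_bar a b1 b2) * (1 + fps_const (1 / (a + b1)) * u) =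
      fps_const (alpha_bar a b1 b2) + (fps_const (alpha_bar a b1 b2) * fps_const (1 / (a + b1))) * u"
    by (simp only: distrib_left mult_1_right mult.assoc)
  also have "\<dots> = q * fps_const (a + b1) + q * u"
    by (simp only: cs(2)) (simp only: cs(1))
  finally have F: "fps_const (alpha_bar a b1 b2) * (1 + fps_const (1 / (a + b1)) * u) =
      q * fps_const (a + b1) + q * u" .
  have ring: "A * (G * X) - G * Y = G * (A * X - Y)" for A X Y :: "real fps"
    by (simp add: algebra_simps)
  have f4: "f4_fps a b1 b2 = G * (q * fps_const (a + b1) + q * u - (1 + p * v))"
    unfolding f4_fps_def zbal_conv_logder[OF assms(1,2)] G_def[symmetric] u_def[symmetric]
      v_def[symmetric] p_def[symmetric] ring F ..
  have G: "fps_theta G = u * G"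
    unfolding G_def u_def logder_mult ..
  have ric: "x = y - z" if "x + z = y" for x y z :: "real fps"
    using that by (simp add: algebra_simps)
  have u: "q * fps_theta u = p * fps_const (a * b2) * fps_geom - q * (u * u + fps_const (a + b1) * u)"
  proof -
    have "fps_theta u = fps_const (a * b1) * fps_geom - (u * u + fps_const (a + b1) * u)"
      by (rule ric) (simp only: add.assoc[symmetric] u_def logder_riccati[OF assms(1,2)])
    hence "q * fps_theta u = (q * fps_const (a * b1)) * fps_geom - q * (u * u + fps_const (a + b1) * u)"
      by (simp only: right_diff_distrib mult.assoc)
    thus ?thesis by (simp only: cs(4))
  qed
  have v: "p * fps_theta v = p * fps_const (a * b2) * fps_geom - (p * (v * v) + v)"
  proof -
    have "fps_theta v = fps_const (a * b2) * fps_geom - (v * v + fps_const (a + b2) * v)"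
      by (rule ric) (simp only: add.assoc[symmetric] v_def logder_riccati[OF assms(1,3)])
    hence "p * fps_theta v = p * fps_const (a * b2) * fps_geom - (p * (v * v) + (p * fps_const (a + b2)) * v)"
      by (simp only: right_diff_distrib distrib_left mult.assoc)
    thus ?thesis by (simp only: cs(3) mult_1)
  qed
  have "fps_theta (q * fps_const (a + b1) + q * u - (1 + p * v)) = q * fps_theta u - p * fps_theta v"
    by (simp add: fps_theta_add fps_theta_diff fps_theta_mult fps_theta_const fps_theta_one q_def p_def
        del: fps_const_add)
  hence "fps_theta (f4_fps a b1 b2) =
      u * G * (q * fps_const (a + b1) + q * u - (1 + p * v)) + G * (q * fps_theta u - p * fps_theta v)"
    by (simp only: f4 fps_theta_mult G)
  also have "\<dots> = G * ((1 + p * v) * (v - u))"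
  proof -
    \<comment> \<open>M is the common source p a b2 X/(1 - X). After both Riccati equations are
      substituted, a ring identity remains.\<close>
    have "u * G * (q * C + q * u - (1 + p * v)) + G * ((M - q * (u * u + C * u)) - (M - (p * (v * v) + v))) =
        G * ((1 + p * v) * (v - u))" for G C M p q u v :: "real fps"
      by (simp add: algebra_simps)
    thus ?thesis unfolding u v .
  qed
  finally show ?thesis by (simp only: G_def u_def v_def p_def)
qed

lemma f4_fps_nth_0:
  assumes "a > 0" "b1 > 0" "b2 > 0"
  shows "fps_nth (f4_fps a b1 b2) 0 = a * (b2 - b1) / (b1 * (a + b2))"
proof -
  have "a + b2 > 0" using assms by simp
  thus ?thesis using assms by (simp add: f4_fps_def alpha_bar_def divide_simps) (simp add: algebra_simps)
qed

lemma fps_mult_nth_ge: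
  fixes f g :: "real fps"
  assumes "\<And>n. fps_nth f n \<ge> 0" "\<And>n. fps_nth g n \<ge> 0" "i \<le> n"
  shows "fps_nth f i * fps_nth g (n - i) \<le> fps_nth (f * g) n"
  unfolding fps_mult_nth using assms
  by (intro member_le_sum[of i _ "\<lambda>i. fps_nth f i * fps_nth g (n - i)"]) auto

text \<open>For n > 0, n times the coefficient is a convolution of nonnegative series. Strictness
  comes from one product: coefficient n - 1 of G_1, the constant term 1 of P, and the first
  coefficient of w_2 - w_1.\<close>

lemma f4_fps_nth_pos:
  assumes "a > 0" "b1 > 0" "b1 < b2"
  shows "fps_nth (f4_fps a b1 b2) n > 0"
proof (cases n)
  case 0
  thus ?thesis using assms by (simp add: f4_fps_nth_0)
next
  case (Suc m)
  have b2: "b2 > 0" using assms by simp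
  define P where "P = 1 + fps_const (1 / (a + b2)) * logder a b2"
  define E where "E = logder a b2 - logder a b1"
  have P: "fps_nth P i \<ge> 0" for i
    using assms b2 logder_nth_nonneg[OF assms(1) b2, of i] by (auto simp: P_def)
  have E: "fps_nth E i \<ge> 0" for i
    using logder_nth_mono[OF assms, of i] by (simp add: E_def)
  have PE: "fps_nth P 0 * fps_nth E (i - 0) \<le> fps_nth (P * E) i" for i
    by (intro fps_mult_nth_ge P E) auto
  hence PE: "fps_nth E i \<le> fps_nth (P * E) i" for i
    by (simp add: P_def)
  have "0 < fps_nth (zbal1 a b1) m * fps_nth E 1"
    using logder_nth_1_strict_mono[OF assms] zbal1_pos[OF assms(1,2), of m] by (simp add: E_def)
  also have "\<dots> \<le> fps_nth (zbal1 a b1) m * fps_nth (P * E) 1"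
    by (intro mult_left_mono PE less_imp_le[OF zbal1_pos] assms)
  also have "\<dots> \<le> fps_nth (zbal1 a b1 * (P * E)) n"
    using fps_mult_nth_ge[of "zbal1 a b1" "P * E" m n] Suc
      less_imp_le[OF zbal1_pos[OF assms(1,2)]] order.trans[OF E PE] by simp
  also have "\<dots> = real n * fps_nth (f4_fps a b1 b2) n"
    unfolding P_def E_def fps_theta_f4_fps[OF assms(1,2) b2, symmetric] by simp
  finally show ?thesis by (simp add: zero_less_mult_iff)
qed

lemma fps_conv_radius_ge_1_closed:
  fixes f g :: "real fps"
  assumes "fps_conv_radius f \<ge> 1" "fps_conv_radius g \<ge> 1"
  shows "fps_conv_radius (f + g) \<ge> 1" "fps_conv_radius (f - g) \<ge> 1" "fps_conv_radius (f * g) \<ge> 1"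
  using order.trans[OF min.boundedI[OF assms] fps_conv_radius_add]
    order.trans[OF min.boundedI[OF assms] fps_conv_radius_diff]
    order.trans[OF min.boundedI[OF assms] fps_conv_radius_mult] by blast+

lemma fps_conv_radius_logder_factor:
  assumes "a > 0" "b > 0"
  shows "fps_conv_radius (1 + fps_const (1 / (a + b)) * logder a b) \<ge> 1"
  by (rule fps_conv_radius_ge_1_closed(1)[OF _ fps_conv_radius_ge_1_closed(3)[OF _ logder_conv_radius[OF assms]]])
    simp_all

lemma f4_fps_conv_radius:
  assumes "a > 0" "b1 > 0" "b2 > 0"
  shows "fps_conv_radius (f4_fps a b1 b2) \<ge> 1"
  unfolding f4_fps_def
  by (rule fps_conv_radius_ge_1_closed(2)[OF
        fps_conv_radius_ge_1_closed(3)[OF _ zbal_conv_radius[OF assms(1,2)]]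
        fps_conv_radius_ge_1_closed(3)[OF zbal1_conv_radius[OF assms(1,2)]
          fps_conv_radius_logder_factor[OF assms(1,3)]]]) simp

lemma hyp2F1_zbal: "hyp2F1 a b (a + b) r = eval_fps (zbal a b) r"
  and hyp2F1_zbal1: "hyp2F1 a b (a + b + 1) r = eval_fps (zbal1 a b) r"
  by (simp_all add: hyp2F1_def zbal_def zbal1_def)

lemma eval_zbal_logder:
  assumes "a > 0" "b > 0" "\<bar>r\<bar> < 1"
  shows "eval_fps (zbal a b) r = eval_fps (zbal1 a b) r * eval_fps (1 + fps_const (1 / (a + b)) * logder a b) r"
  unfolding zbal_conv_logder[OF assms(1,2)]
  by (rule eval_fps_mult[OF less_fps_conv_radius[OF zbal1_conv_radius[OF assms(1,2)] assms(3)]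
        less_fps_conv_radius[OF fps_conv_radius_logder_factor[OF assms(1,2)] assms(3)]])

lemma Lambda3_altdef:
  assumes "a > 0" "b1 > 0" "0 < r" "r < 1"
  shows "Lambda3 a b1 b2 r = eval_fps (zbal1 a b1) r * eval_fps (zbal a b2) r / eval_fps (zbal1 a b2) r"
  using eval_zbal_gt_1[OF assms] by (simp add: Lambda3_def Lambda2_def hyp2F1_zbal hyp2F1_zbal1)

lemma eval_f4_fps:
  assumes "a > 0" "b1 > 0" "b2 > 0" "0 < r" "r < 1"
  shows "eval_fps (f4_fps a b1 b2) r = f4 a b1 b2 r"
proof -
  have r: "\<bar>r\<bar> < 1" using assms by simp
  let ?P = "1 + fps_const (1 / (a + b2)) * logder a b2"
  have P: "fps_conv_radius ?P \<ge> 1"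
    by (rule fps_conv_radius_logder_factor[OF assms(1,3)])
  have 1: "fps_conv_radius (zbal1 a b1 * ?P) \<ge> 1"
    by (rule fps_conv_radius_ge_1_closed(3)[OF zbal1_conv_radius[OF assms(1,2)] P])
  have 2: "fps_conv_radius (fps_const (alpha_bar a b1 b2) * zbal a b1) \<ge> 1"
    by (rule fps_conv_radius_ge_1_closed(3)[OF _ zbal_conv_radius[OF assms(1,2)]]) simp
  have "eval_fps (f4_fps a b1 b2) r = alpha_bar a b1 b2 * eval_fps (zbal a b1) r -
      eval_fps (zbal1 a b1) r * eval_fps ?P r"
    unfolding f4_fps_def
    using less_fps_conv_radius[OF 1 r] less_fps_conv_radius[OF 2 r] less_fps_conv_radius[OF P r]
      less_fps_conv_radius[OF zbal_conv_radius[OF assms(1,2)] r]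
      less_fps_conv_radius[OF zbal1_conv_radius[OF assms(1,2)] r]
    by (simp add: eval_fps_diff eval_fps_mult)
  also have "eval_fps ?P r = eval_fps (zbal a b2) r / eval_fps (zbal1 a b2) r"
    using eval_zbal_logder[OF assms(1,3) r] eval_zbal1_ge_1[OF assms(1,3), of r] assms by simp
  finally show ?thesis
    by (simp add: f4_def Lambda3_altdef[OF assms(1,2,4,5)] hyp2F1_zbal)
qed

text \<open>With g_i = G_i(1) one has \<alpha> B2/B1 = g1/g2, hence f4 = (\<alpha>/B1)(B1 F1 - B2
  F2) + F2 (g1/g2 - G1/G2). In the first part the logarithms cancel and psi(b2) - psi(b1) remains;
  the second is a combination of the products F2 (g_i - G_i) over g2 G2 and vanishes.\<close>

lemma f4_tendsto:
  assumes "a > 0" "0 < b1" "b1 \<le> b2"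
  shows "(f4 a b1 b2 \<longlongrightarrow> alpha_bar a b1 b2 * beta_bar a b1 b2) (at_left 1)"
proof -
  have b2: "b2 > 0" using assms by simp
  define B1 where "B1 = Beta a b1"
  define B2 where "B2 = Beta a b2"
  have B: "B1 > 0" "B2 > 0" using assms by (auto simp: B1_def B2_def Beta_real_pos)
  let ?F1 = "eval_fps (zbal a b1)" and ?F2 = "eval_fps (zbal a b2)"
    and ?G1 = "eval_fps (zbal1 a b1)" and ?G2 = "eval_fps (zbal1 a b2)"
  define g1 where "g1 = (a + b1) / (a * b1 * B1)"
  define g2 where "g2 = (a + b2) / (a * b2 * B2)"
  define \<alpha> where "\<alpha> = alpha_bar a b1 b2"
  have g2: "g2 \<noteq> 0" using assms b2 B by (simp add: g2_def)
  have \<alpha>: "\<alpha> * B2 / B1 = g1 / g2"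
  proof -
    have "a + b1 > 0" "a + b2 > 0" using assms b2 by auto
    thus ?thesis
      using assms b2 B by (simp add: \<alpha>_def g1_def g2_def alpha_bar_def divide_simps)
  qed
  have "((\<lambda>r. (\<alpha> / B1) * (B1 * ?F1 r - B2 * ?F2 r) +
      (g2 * (?F2 r * (g1 - ?G1 r)) - g1 * (?F2 r * (g2 - ?G2 r))) / (g2 * ?G2 r)) \<longlongrightarrow>
      (\<alpha> / B1) * (Digamma b2 - Digamma b1) + (g2 * 0 - g1 * 0) / (g2 * g2)) (at_left 1)"
    unfolding g1_def g2_def B1_def B2_def using assms b2 B
    by (intro tendsto_intros Beta_zbal_diff_tendsto zbal_zbal1_gap_tendsto eval_zbal1_tendsto)
       (auto simp: B2_def)
  hence "((\<lambda>r. (\<alpha> / B1) * (B1 * ?F1 r - B2 * ?F2 r) +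
      (g2 * (?F2 r * (g1 - ?G1 r)) - g1 * (?F2 r * (g2 - ?G2 r))) / (g2 * ?G2 r)) \<longlongrightarrow>
      alpha_bar a b1 b2 * beta_bar a b1 b2) (at_left 1)"
    by (simp add: \<alpha>_def beta_bar_def B1_def)
  moreover have "eventually (\<lambda>r. (\<alpha> / B1) * (B1 * ?F1 r - B2 * ?F2 r) +
      (g2 * (?F2 r * (g1 - ?G1 r)) - g1 * (?F2 r * (g2 - ?G2 r))) / (g2 * ?G2 r) = f4 a b1 b2 r) (at_left 1)"
    using eventually_unit_at_left_1
  proof eventually_elim
    case (elim r)
    hence G2: "?G2 r \<noteq> 0" using eval_zbal1_ge_1[OF assms(1) b2, of r] by auto
    have "(g2 * (?F2 r * (g1 - ?G1 r)) - g1 * (?F2 r * (g2 - ?G2 r))) / (g2 * ?G2 r) =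
        (g1 / g2) * ?F2 r - ?G1 r * ?F2 r / ?G2 r"
      using G2 g2 by (simp add: field_simps)
    thus ?case
      using Lambda3_altdef[OF assms(1,2), of r b2] elim B
      unfolding \<alpha>[symmetric] f4_def hyp2F1_zbal \<alpha>_def[symmetric] by (simp add: field_simps)
  qed
  ultimately show ?thesis by (rule Lim_transform_eventually)
qed

text \<open>Monotonicity, range, absolute monotonicity and the partial-sum bounds use only these
  facts about \<open>f4\<close>. \<open>f\<close> is tied to the series inside (0,1) alone, and L is
  a one-sided limit, so information at the ends has to come from the series at 0 or from
  limits.\<close>

locale pos_power_series =
  fixes P :: "real fps" and f :: "real \<Rightarrow> real" and L :: real
  assumes coeff_pos: "fps_nth P n > 0"
    and conv_radius: "fps_conv_radius P \<ge> 1"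
    and eval_eq: "0 < r \<Longrightarrow> r < 1 \<Longrightarrow> eval_fps P r = f r"
    and limit: "(f \<longlongrightarrow> L) (at_left 1)"
begin

lemma eval_sums: "0 \<le> r \<Longrightarrow> r < 1 \<Longrightarrow> (\<lambda>n. fps_nth P n * r ^ n) sums eval_fps P r"
  by (intro sums_eval_fps less_fps_conv_radius conv_radius) auto

lemma f_sums: "0 < r \<Longrightarrow> r < 1 \<Longrightarrow> (\<lambda>n. fps_nth P n * r ^ n) sums f r"
  using eval_sums[of r] eval_eq[of r] by simp

lemma eval_strict_mono:
  assumes "0 \<le> x" "x < y" "y < 1"
  shows "eval_fps P x < eval_fps P y"
proof -
  have "(\<lambda>n. fps_nth P n * y ^ n - fps_nth P n * x ^ n) sums (eval_fps P y - eval_fps P x)"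
    using assms by (intro sums_diff eval_sums) auto
  moreover have "fps_nth P n * y ^ n - fps_nth P n * x ^ n \<ge> 0" for n
    using assms coeff_pos[of n] by (simp add: mult_left_mono power_mono)
  moreover have "fps_nth P 1 * y ^ 1 - fps_nth P 1 * x ^ 1 > 0"
    using assms coeff_pos[of 1] by simp
  ultimately have "eval_fps P y - eval_fps P x > 0"
    using suminf_pos2[of "\<lambda>n. fps_nth P n * y ^ n - fps_nth P n * x ^ n" 1]
    by (simp add: sums_iff)
  thus ?thesis by simp
qed

lemma f_less_f:
  assumes "0 < x" "x < y" "y < 1"
  shows "f x < f y"
  using eval_strict_mono[of x y] eval_eq[of x] eval_eq[of y] assms by simp

lemma strict_mono: "strict_mono_on {0<..<1} f"
  by (auto intro!: strict_mono_onI f_less_f)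

lemma coeff_0_less:
  assumes "0 < r" "r < 1"
  shows "fps_nth P 0 < f r"
  using eval_strict_mono[of 0 r] eval_eq[of r] assms by (simp add: eval_fps_at_0)

lemma less_limit:
  assumes "0 < r" "r < 1"
  shows "f r < L"
proof -
  obtain s where s: "r < s" "s < 1" using assms dense by blast
  have "f s \<le> L"
  proof (rule tendsto_lowerbound[OF limit])
    have "eventually (\<lambda>x. x \<in> {s<..<1}) (at_left 1)"
      by (rule eventually_at_left_real) (use s in auto)
    thus "\<forall>\<^sub>F x in at_left 1. f s \<le> f x"
      by eventually_elim (use s assms in \<open>auto intro!: less_imp_le f_less_f\<close>)
  qed auto
  with f_less_f[of r s] s assms show ?thesis by simp
qed

lemma image: "f ` {0<..<1} = {fps_nth P 0<..<L}"
proof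
  show "f ` {0<..<1} \<subseteq> {fps_nth P 0<..<L}"
    using coeff_0_less less_limit by auto
  show "{fps_nth P 0<..<L} \<subseteq> f ` {0<..<1}"
  proof
    fix y assume y: "y \<in> {fps_nth P 0<..<L}"
    have "eventually (\<lambda>r. f r > y) (at_left 1)"
      using order_tendstoD(1)[OF limit] y by simp
    with eventually_unit_at_left_1 have "eventually (\<lambda>r. (0 < r \<and> r < 1) \<and> f r > y) (at_left 1)"
      by eventually_elim auto
    then obtain s where s: "0 < s" "s < 1" "f s > y"
      using eventually_happens'[of "at_left (1::real)"] by force
    \<comment> \<open>The intermediate value theorem is applied to the series, which unlike
      \<open>f\<close> is known at 0; its value there is the open lower end of the range.\<close>
    have "continuous_on {0..s} (eval_fps P)"
    proof (rule continuous_on_subset[OF continuous_on_eval_fps], rule subsetI)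
      fix x assume "x \<in> {0..s}"
      hence "\<bar>x\<bar> < 1" using s by auto
      from less_fps_conv_radius[OF conv_radius this]
      show "x \<in> eball 0 (fps_conv_radius P)" by simp
    qed
    moreover have "eval_fps P 0 \<le> y" "y \<le> eval_fps P s"
      using y s eval_eq[of s] by (auto simp: eval_fps_at_0)
    ultimately obtain x where x: "0 \<le> x" "x \<le> s" "eval_fps P x = y"
      using IVT'[of "eval_fps P" 0 y s] s(1) by (metis less_imp_le)
    have "x \<noteq> 0" using x(3) y by (auto simp: eval_fps_at_0)
    hence "0 < x" "x < 1" using x s by auto
    hence "f x = y" using eval_eq[of x] x(3) by simp
    with \<open>0 < x\<close> \<open>x < 1\<close> show "y \<in> f ` {0<..<1}" by force
  qed
qed

lemma partial_sum_less:
  assumes "0 < r" "r < 1"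
  shows "(\<Sum>k=0..n. fps_nth P k * r ^ k) < f r"
  using sum_less_suminf[of "\<lambda>k. fps_nth P k * r ^ k" "Suc n"] f_sums[OF assms] coeff_pos assms
  by (simp add: sums_iff atLeast0AtMost lessThan_Suc_atMost)

text \<open>Finite sums pass to the limit r -> 1 one at a time. This yields summability of the
  coefficients, with sum at most L.\<close>

lemma partial_sum_1_le: "(\<Sum>k<n. fps_nth P k) \<le> L"
proof (rule tendsto_le[OF _ limit])
  have "((\<lambda>r::real. \<Sum>k<n. fps_nth P k * r ^ k) \<longlongrightarrow> (\<Sum>k<n. fps_nth P k * 1 ^ k)) (at_left 1)"
    by (intro tendsto_intros)
  thus "((\<lambda>r::real. \<Sum>k<n. fps_nth P k * r ^ k) \<longlongrightarrow> (\<Sum>k<n. fps_nth P k)) (at_left 1)" by simp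
  show "\<forall>\<^sub>F r in at_left 1. (\<Sum>k<n. fps_nth P k * r ^ k) \<le> f r"
    using eventually_unit_at_left_1
  proof eventually_elim
    case (elim r)
    have "(\<Sum>k<n. fps_nth P k * r ^ k) \<le> (\<Sum>k=0..n. fps_nth P k * r ^ k)"
      using elim coeff_pos by (intro sum_mono2) (auto intro: less_imp_le)
    with partial_sum_less[of r n] elim show ?case by simp
  qed
qed auto

lemma less_partial_sum_plus:
  assumes "0 < r" "r < 1"
  shows "f r < (\<Sum>k=0..n. fps_nth P k * r ^ k) + (L - (\<Sum>k=0..n. fps_nth P k)) * r ^ Suc n"
proof -
  let ?u = "\<lambda>k. fps_nth P k"
  have summ: "summable ?u"
    using partial_sum_1_le coeff_pos by (intro summableI_nonneg_bounded[of _ L]) (auto intro: less_imp_le)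
  have suminf: "suminf ?u \<le> L"
    by (intro suminf_le_const summ partial_sum_1_le)
  define N where "N = Suc n"
  have f: "f r = (\<Sum>k. ?u (k + N) * r ^ (k + N)) + (\<Sum>k<N. ?u k * r ^ k)"
    using suminf_split_initial_segment[of "\<lambda>k. ?u k * r ^ k" N] f_sums[OF assms] by (simp add: sums_iff)
  have s1: "summable (\<lambda>k. ?u (k + N) * r ^ (k + N))"
    using summable_ignore_initial_segment[of "\<lambda>k. ?u k * r ^ k" N] f_sums[OF assms] by (simp add: sums_iff)
  have s2: "(\<lambda>k. ?u (k + N) * r ^ N) sums ((suminf ?u - (\<Sum>k<N. ?u k)) * r ^ N)"
    by (intro sums_mult2 sums_split_initial_segment summable_sums summ)
  have "(\<Sum>k. ?u (k + N) * r ^ N - ?u (k + N) * r ^ (k + N)) > 0"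
  proof (rule suminf_pos2)
    show "summable (\<lambda>k. ?u (k + N) * r ^ N - ?u (k + N) * r ^ (k + N))"
      by (intro summable_diff s1 sums_summable[OF s2])
    show "0 \<le> ?u (k + N) * r ^ N - ?u (k + N) * r ^ (k + N)" for k
      using assms coeff_pos[of "k + N"] power_decreasing[of N "k + N" r] by (simp add: mult_left_mono)
    \<comment> \<open>For k = 0 both powers equal r^N, so strictness is taken from k = 1.\<close>
    show "0 < ?u (1 + N) * r ^ N - ?u (1 + N) * r ^ (1 + N)"
      using assms coeff_pos[of "1 + N"] by simp
  qed
  hence "(\<Sum>k. ?u (k + N) * r ^ (k + N)) < (suminf ?u - (\<Sum>k<N. ?u k)) * r ^ N"
    using suminf_diff[OF sums_summable[OF s2] s1] s2 by (simp add: sums_iff)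
  also have "\<dots> \<le> (L - (\<Sum>k<N. ?u k)) * r ^ N"
    using assms suminf by (intro mult_right_mono) auto
  finally show ?thesis unfolding f N_def by (simp add: atLeast0AtMost lessThan_Suc_atMost)
qed

lemma partial_sum_plus_le:
  assumes "0 < r" "r < 1"
  shows "(\<Sum>k=0..n. fps_nth P k * r ^ k) + (L - (\<Sum>k=0..n. fps_nth P k)) * r ^ Suc n \<le> L"
proof -
  have "(\<Sum>k=0..n. fps_nth P k * r ^ k) \<le> (\<Sum>k=0..n. fps_nth P k)"
    using assms coeff_pos by (intro sum_mono) (simp add: mult_left_le power_le_one)
  moreover have "(L - (\<Sum>k=0..n. fps_nth P k)) * r ^ Suc n \<le> L - (\<Sum>k=0..n. fps_nth P k)"
    using assms partial_sum_1_le[of "Suc n"]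
    by (intro mult_left_le power_le_one) (auto simp: atLeast0AtMost lessThan_Suc_atMost)
  ultimately show ?thesis by linarith
qed

end

lemma higher_deriv_eval_fps:
  fixes P :: "real fps"
  assumes "fps_conv_radius P \<ge> 1" "\<bar>x\<bar> < 1"
  shows "(deriv ^^ n) (eval_fps P) x = eval_fps ((fps_deriv ^^ n) P) x"
  using assms(1)
proof (induction n arbitrary: P)
  case (Suc n)
  have "(deriv ^^ Suc n) (eval_fps P) x = (deriv ^^ n) (deriv (eval_fps P)) x"
    unfolding funpow_Suc_right o_def ..
  also have "eventually (\<lambda>z. z \<in> {-1<..<1}) (nhds x)"
    using assms(2) by (intro eventually_nhds_in_open) auto
  \<comment> \<open>The innermost derivative is replaced on a neighbourhood of x, since the n
    remaining derivatives see more than the value at x.\<close>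
  hence "eventually (\<lambda>z. deriv (eval_fps P) z = eval_fps (fps_deriv P) z) (nhds x)"
  proof eventually_elim
    case (elim z)
    hence "ereal (norm z) < fps_conv_radius P" by (intro less_fps_conv_radius Suc.prems) auto
    thus ?case by (simp add: eval_fps_deriv)
  qed
  hence "(deriv ^^ n) (deriv (eval_fps P)) x = (deriv ^^ n) (eval_fps (fps_deriv P)) x"
    by (intro higher_deriv_cong_ev refl)
  also have "\<dots> = eval_fps ((fps_deriv ^^ n) (fps_deriv P)) x"
    by (rule Suc.IH) (rule order.trans[OF Suc.prems fps_conv_radius_deriv])
  finally show ?case by (simp only: funpow_Suc_right o_def)
qed auto

lemma fps_conv_radius_higher_deriv:
  fixes P :: "real fps"
  shows "fps_conv_radius ((fps_deriv ^^ n) P) \<ge> fps_conv_radius P"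
  by (induction n) (auto intro: order.trans[OF _ fps_conv_radius_deriv])

context pos_power_series
begin

lemma absolutely_monotone: "absolutely_monotone_on f {0<..<1}"
  unfolding absolutely_monotone_on_def
proof (intro allI ballI conjI)
  fix n and x :: real assume x: "x \<in> {0<..<1}"
  let ?Q = "(fps_deriv ^^ n) P"
  have Q: "fps_conv_radius ?Q \<ge> 1"
    by (rule order.trans[OF conv_radius fps_conv_radius_higher_deriv])
  have eq: "(deriv ^^ n) f z = eval_fps ?Q z" if z: "z \<in> {0<..<1}" for z
  proof -
    have "eventually (\<lambda>y. y \<in> {0<..<1}) (nhds z)"
      using z by (intro eventually_nhds_in_open) auto
    hence "eventually (\<lambda>y. f y = eval_fps P y) (nhds z)"
      by eventually_elim (simp add: eval_eq)
    hence "(deriv ^^ n) f z = (deriv ^^ n) (eval_fps P) z"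
      by (intro higher_deriv_cong_ev refl)
    thus ?thesis using higher_deriv_eval_fps[OF conv_radius, of z] z by simp
  qed
  have "((deriv ^^ n) f has_field_derivative eval_fps (fps_deriv ?Q) x) (at x)"
  proof (rule has_field_derivative_transform_within_open)
    show "(eval_fps ?Q has_field_derivative eval_fps (fps_deriv ?Q) x) (at x)"
      using x by (intro has_field_derivative_eval_fps less_fps_conv_radius Q) auto
    show "eval_fps ?Q z = (deriv ^^ n) f z" if "z \<in> {0<..<1}" for z
      using eq[OF that] by simp
  qed (use x in auto)
  thus "(deriv ^^ n) f differentiable (at x)"
    by (auto simp: real_differentiable_def)
  have nonneg: "fps_nth ?Q k \<ge> 0" for k
  proof (induction n arbitrary: k)
    case 0
    show ?case using coeff_pos[of k] by simp
  qed simp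
  have sums: "(\<lambda>k. fps_nth ?Q k * x ^ k) sums eval_fps ?Q x"
    using x by (intro sums_eval_fps less_fps_conv_radius Q) auto
  have "0 \<le> eval_fps ?Q x"
    by (rule sums_le[OF _ sums_zero sums]) (use x nonneg in simp)
  thus "0 \<le> (deriv ^^ n) f x"
    by (simp only: eq[OF x])
qed

end

lemma f4_power_series:
  assumes "a > 0" "0 < b1" "b1 < b2"
  shows "pos_power_series (f4_fps a b1 b2) (f4 a b1 b2) (alpha_bar a b1 b2 * beta_bar a b1 b2)"
  using assms
  by unfold_locales (auto intro!: f4_fps_nth_pos f4_fps_conv_radius eval_f4_fps f4_tendsto)

section \<open>Dependence on the parameters\<close>

text \<open>Each factor (x + k)/(x + d + k) lies in [0,1] and has derivative between 0 and 1/x, so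
  the product rule adds at most 1/x per factor. Growth linear in n keeps the termwise differentiated
  series dominated in \<open>hyp2F1_differentiable\<close>.\<close>

lemma pochhammer_quotient_derivative:
  fixes x d :: real
  assumes "x > 0" "d \<ge> 0"
  shows "\<exists>D. ((\<lambda>x. pochhammer x n / pochhammer (x + d) n) has_real_derivative D) (at x) \<and> \<bar>D\<bar> \<le> n / x"
proof (induction n)
  case 0
  show ?case by (auto intro!: exI[of _ 0])
next
  case (Suc n)
  let ?p = "\<lambda>n x. pochhammer x n / pochhammer (x + d) n"
  from Suc obtain D where D: "(?p n has_real_derivative D) (at x)" "\<bar>D\<bar> \<le> n / x"
    by blast
  define q where "q = (x + n) / (x + d + n)"
  define q' where "q' = d / (x + d + n)\<^sup>2"
  have pos: "x + d + n > 0" using assms by simp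
  have "((\<lambda>x. (x + n) / (x + d + n)) has_real_derivative q') (at x)"
    unfolding q'_def using pos
    by (auto intro!: derivative_eq_intros simp: power2_eq_square divide_simps)
  from DERIV_mult[OF D(1) this]
  have "((\<lambda>x. ?p n x * ((x + n) / (x + d + n))) has_real_derivative D * q + q' * ?p n x) (at x)"
    by (simp only: q_def)
  also have "(\<lambda>x. ?p n x * ((x + n) / (x + d + n))) = ?p (Suc n)"
    by (simp add: pochhammer_rec' mult_ac)
  finally have der: "(?p (Suc n) has_real_derivative D * q + q' * ?p n x) (at x)" .
  have q: "0 \<le> q" "q \<le> 1" using assms pos by (auto simp: q_def)
  have p: "0 \<le> ?p n x" "?p n x \<le> 1"
  proof -
    have "pochhammer x n > 0" "pochhammer (x + d) n > 0"
      using assms by (auto intro!: pochhammer_pos)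
    moreover have "pochhammer x n \<le> pochhammer (x + d) n"
      unfolding pochhammer_prod using assms by (intro prod_mono) auto
    ultimately show "0 \<le> ?p n x" "?p n x \<le> 1" by auto
  qed
  have q': "0 \<le> q'" "q' \<le> 1 / x"
  proof -
    show "0 \<le> q'" using assms by (simp add: q'_def)
    have "q' = (d / (x + d + n)) / (x + d + n)" by (simp add: q'_def power2_eq_square)
    also have "\<dots> \<le> 1 / x" using assms pos by (intro frac_le) auto
    finally show "q' \<le> 1 / x" .
  qed
  have "\<bar>D * q + q' * ?p n x\<bar> \<le> \<bar>D\<bar> * q + q' * ?p n x"
  proof -
    have "\<bar>D * q\<bar> = \<bar>D\<bar> * q" using q by (simp add: abs_mult)
    moreover have "\<bar>q' * ?p n x\<bar> = q' * ?p n x"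
      by (rule abs_of_nonneg[OF mult_nonneg_nonneg[OF q'(1) p(1)]])
    ultimately show ?thesis by (metis abs_triangle_ineq)
  qed
  also have "\<dots> \<le> n / x * 1 + 1 / x * 1"
    using D(2) q p q' assms by (intro add_mono mult_mono) auto
  also have "\<dots> = Suc n / x" by (simp add: add_divide_distrib)
  finally show ?case using der by blast
qed

lemma summable_pochhammer_powser:
  fixes A r :: real
  assumes "A > 0" "0 \<le> r" "r < 1"
  shows "summable (\<lambda>n. (real n + 1) * (pochhammer A n / fact n) * r ^ n)"
proof -
  let ?u = "\<lambda>n. (real n + 1) * (pochhammer A n / fact n)"
  have "conv_radius ?u = 1"
  proof (rule conv_radius_ratio_limit_nonzero)
    have "(\<lambda>n. (real n + 1) / (real n + 2) * ((real n + 1) / (A + real n))) \<longlonglongrightarrow> 1"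
      by real_asymp
    also have "(\<lambda>n. (real n + 1) / (real n + 2) * ((real n + 1) / (A + real n))) =
        (\<lambda>n. norm (?u n) / norm (?u (Suc n)))"
    proof
      fix n
      have "pochhammer A n > 0" using assms by (intro pochhammer_pos)
      thus "(real n + 1) / (real n + 2) * ((real n + 1) / (A + real n)) = norm (?u n) / norm (?u (Suc n))"
        using assms by (simp add: pochhammer_rec' divide_simps) (simp add: algebra_simps)
    qed
    finally show "(\<lambda>n. norm (?u n) / norm (?u (Suc n))) \<longlonglongrightarrow> 1" .
  qed (simp_all add: one_ereal_def)
  thus ?thesis
    using assms by (intro summable_in_conv_radius) simp_all
qed

text \<open>The lower parameter is tied to the variable by a fixed difference, since b and c = a + b
  move together in statement (1).\<close>

lemma hyp2F1_differentiable:
  fixes A d r x0 :: real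
  assumes "A > 0" "d \<ge> 0" "0 \<le> r" "r < 1" "x0 > 0"
  shows "(\<lambda>x. hyp2F1 A x (x + d) r) differentiable (at x0)"
proof -
  let ?p = "\<lambda>n x. pochhammer x n / pochhammer (x + d) n"
  define u where "u n = pochhammer A n / fact n * r ^ n" for n
  have u: "u n \<ge> 0" for n using pochhammer_pos[OF assms(1), of n] assms by (simp add: u_def)
  have summ: "summable (\<lambda>n. (real n + 1) * u n)"
    using summable_pochhammer_powser[OF assms(1,3,4)] by (simp add: u_def mult_ac)
  define D where "D n = deriv (?p n)" for n
  have D: "(?p n has_real_derivative D n x) (at x)" "\<bar>D n x\<bar> \<le> n / x" if x: "x > 0" for n x
  proof -
    obtain E where E: "(?p n has_real_derivative E) (at x)" "\<bar>E\<bar> \<le> n / x"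
      using pochhammer_quotient_derivative[OF x assms(2)] by blast
    with DERIV_imp_deriv[OF E(1)]
    show "(?p n has_real_derivative D n x) (at x)" "\<bar>D n x\<bar> \<le> n / x" by (simp_all add: D_def)
  qed
  have "(\<lambda>x. \<Sum>n. u n * ?p n x) differentiable (at x0)"
  proof (rule differentiable_series')
    \<comment> \<open>Staying to the right of x0/2 makes the bound n/x on the derivatives
      uniform.\<close>
    show "convex {x0 / 2<..}" "open {x0 / 2<..}" "x0 \<in> {x0 / 2<..}" using assms by auto
    show "((\<lambda>x. u n * ?p n x) has_field_derivative u n * D n x) (at x)" if "x \<in> {x0 / 2<..}" for n x
      using that assms by (intro DERIV_cmult D) auto
    show "uniformly_convergent_on {x0 / 2<..} (\<lambda>n x. \<Sum>i<n. u i * D i x)"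
    proof (rule Weierstrass_m_test')
      show "summable (\<lambda>n. (real n + 1) * u n * (2 / x0))"
        by (intro summable_mult2 summ)
      fix n x assume "x \<in> {x0 / 2<..}"
      hence x: "x > x0 / 2" "x > 0" using assms by auto
      have "\<bar>D n x\<bar> \<le> n / x" using D(2)[OF x(2)] .
      also have "\<dots> \<le> (real n + 1) / (x0 / 2)" using x assms by (intro frac_le) auto
      finally have "u n * \<bar>D n x\<bar> \<le> u n * ((real n + 1) / (x0 / 2))"
        by (intro mult_left_mono u)
      thus "norm (u n * D n x) \<le> (real n + 1) * u n * (2 / x0)"
        using u[of n] by (simp add: abs_mult mult_ac)
    qed
    show "summable (\<lambda>n. u n * ?p n x0)"
    proof (rule summable_comparison_test'[OF summ])
      fix n
      have "pochhammer x0 n > 0" "pochhammer (x0 + d) n > 0"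
        using assms by (auto intro!: pochhammer_pos)
      moreover have "pochhammer x0 n \<le> pochhammer (x0 + d) n"
        unfolding pochhammer_prod using assms by (intro prod_mono) auto
      ultimately have p: "0 \<le> ?p n x0" "?p n x0 \<le> real n + 1" by (auto simp: divide_le_eq_1 intro: order.trans[of _ 1])
      have "u n * ?p n x0 \<le> u n * (real n + 1)" using p u by (intro mult_left_mono)
      thus "norm (u n * ?p n x0) \<le> (real n + 1) * u n"
        unfolding real_norm_def abs_of_nonneg[OF mult_nonneg_nonneg[OF u p(1)]] by (simp only: mult.commute)
    qed
  qed
  also have "(\<lambda>x. \<Sum>n. u n * ?p n x) = (\<lambda>x. hyp2F1 A x (x + d) r)"
    by (simp add: hyp2F1_altdef u_def mult_ac)
  finally show ?thesis .
qed

text \<open>Dividing by 1 - X forms partial sums, and by \<open>sum_zbal1\<close> those of G are the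
  coefficients of F(a+1,b+1;a+b+1;.). The quotient in statement (1) thereby becomes G/((1 - r) F),
  and \<open>Lambda2\<close> is a ratio of two values of G/F.\<close>

lemma hyp2F1_euler:
  assumes "a > 0" "b > 0" "0 < r" "r < 1"
  shows "hyp2F1 (a + 1) (b + 1) (a + b + 1) r = eval_fps (zbal1 a b) r / (1 - r)"
proof -
  define H :: "real fps" where "H = fps_hypergeo [a + 1, b + 1] [a + b + 1] 1"
  have r: "\<bar>r\<bar> < 1" using assms by simp
  have H: "fps_nth H n = (\<Sum>i\<le>n. fps_nth (zbal1 a b) i)" for n
  proof -
    have "pochhammer (x + 1) n = (x + n) / x * pochhammer x n" if "x > 0" for x :: real
      using pochhammer_rec[of x n] pochhammer_rec'[of x n] that by (simp add: field_simps)
    from this[OF assms(1)] this[OF assms(2)] show ?thesis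
      unfolding sum_zbal1[OF assms(1,2)] by (simp add: H_def zbal1_nth mult_ac)
  qed
  have "fps_conv_radius H \<ge> 1"
  proof (rule fps_conv_radius_ge_1)
    fix n
    have "(\<Sum>i\<le>n. fps_nth (zbal1 a b) i) \<ge> 0"
      by (intro sum_nonneg less_imp_le[OF zbal1_pos] assms)
    moreover have "(\<Sum>i\<le>n. fps_nth (zbal1 a b) i) \<le> (\<Sum>i. fps_nth (zbal1 a b) i)"
      using zbal1_sums[OF assms(1,2)] less_imp_le[OF zbal1_pos[OF assms(1,2)]]
      by (intro sum_le_suminf) (auto simp: sums_iff)
    ultimately show "\<bar>fps_nth H n\<bar> \<le> (\<Sum>i. fps_nth (zbal1 a b) i)" by (simp add: H)
  qed
  note conv = less_fps_conv_radius[OF this r]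
  have "H * (1 - fps_X) = zbal1 a b"
  proof (rule fps_ext)
    fix n
    show "fps_nth (H * (1 - fps_X)) n = fps_nth (zbal1 a b) n"
      by (cases n) (simp_all add: algebra_simps H)
  qed
  moreover have "fps_conv_radius (1 - fps_X :: real fps) \<ge> 1"
    by (rule fps_conv_radius_ge_1_closed(2)) simp_all
  ultimately have "eval_fps (zbal1 a b) r = eval_fps H r * eval_fps (1 - fps_X) r"
    using eval_fps_mult[OF conv less_fps_conv_radius[OF _ r], of "1 - fps_X"] by simp
  also have "eval_fps (1 - fps_X) r = 1 - r"
    by (subst eval_fps_diff) simp_all
  finally show ?thesis using assms by (simp add: hyp2F1_def H_def field_simps)
qed

section \<open>The sign of Lambda2 - 1 near 0\<close>

lemma Lambda2_altdef:
  "Lambda2 a b1 b2 r = eval_fps (zbal1 a b1) r * eval_fps (zbal a b2) r /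
    (eval_fps (zbal a b1) r * eval_fps (zbal1 a b2) r)"
  by (simp add: Lambda2_def hyp2F1_zbal hyp2F1_zbal1)

text \<open>Its sign at \<open>r\<close> is that of \<open>Lambda2 a b1 b2 r - 1\<close>.\<close>

definition cross_fps :: "real \<Rightarrow> real \<Rightarrow> real \<Rightarrow> real fps" where
  "cross_fps a b1 b2 = zbal1 a b1 * zbal a b2 - zbal a b1 * zbal1 a b2"

context
  fixes a b1 b2 :: real
  assumes pos: "a > 0" "b1 > 0" "b2 > 0"
begin

lemma cross_fps_conv_radius: "fps_conv_radius (cross_fps a b1 b2) \<ge> 1"
  unfolding cross_fps_def
  by (rule fps_conv_radius_ge_1_closed(2)[OF
      fps_conv_radius_ge_1_closed(3)[OF zbal1_conv_radius[OF pos(1,2)] zbal_conv_radius[OF pos(1,3)]]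
      fps_conv_radius_ge_1_closed(3)[OF zbal_conv_radius[OF pos(1,2)] zbal1_conv_radius[OF pos(1,3)]]])

lemma eval_cross_fps:
  assumes "\<bar>r\<bar> < 1"
  shows "eval_fps (cross_fps a b1 b2) r =
    eval_fps (zbal1 a b1) r * eval_fps (zbal a b2) r - eval_fps (zbal a b1) r * eval_fps (zbal1 a b2) r"
proof -
  note F1 = less_fps_conv_radius[OF zbal_conv_radius[OF pos(1,2)] assms]
  note F2 = less_fps_conv_radius[OF zbal_conv_radius[OF pos(1,3)] assms]
  note G1 = less_fps_conv_radius[OF zbal1_conv_radius[OF pos(1,2)] assms]
  note G2 = less_fps_conv_radius[OF zbal1_conv_radius[OF pos(1,3)] assms]
  have "ereal (norm r) < fps_conv_radius (zbal1 a b1 * zbal a b2)"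
    "ereal (norm r) < fps_conv_radius (zbal a b1 * zbal1 a b2)"
    by (rule less_fps_conv_radius[OF fps_conv_radius_ge_1_closed(3) assms];
        rule zbal_conv_radius[OF pos(1,2)] zbal_conv_radius[OF pos(1,3)]
          zbal1_conv_radius[OF pos(1,2)] zbal1_conv_radius[OF pos(1,3)])+
  thus ?thesis unfolding cross_fps_def
    using F1 F2 G1 G2 by (simp add: eval_fps_diff eval_fps_mult)
qed

lemma Lambda2_gt_1_iff:
  assumes "0 < r" "r < 1"
  shows "Lambda2 a b1 b2 r > 1 \<longleftrightarrow> eval_fps (cross_fps a b1 b2) r > 0"
    and "Lambda2 a b1 b2 r < 1 \<longleftrightarrow> eval_fps (cross_fps a b1 b2) r < 0"
proof -
  have "eval_fps (zbal a b1) r * eval_fps (zbal1 a b2) r > 0"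
    using eval_zbal_gt_1[OF pos(1,2) assms] eval_zbal1_ge_1[OF pos(1,3), of r] assms
    by (intro mult_pos_pos) auto
  thus "Lambda2 a b1 b2 r > 1 \<longleftrightarrow> eval_fps (cross_fps a b1 b2) r > 0"
    "Lambda2 a b1 b2 r < 1 \<longleftrightarrow> eval_fps (cross_fps a b1 b2) r < 0"
    unfolding Lambda2_altdef using assms
    by (simp_all add: eval_cross_fps less_divide_eq divide_less_eq)
qed

lemma cross_fps_nth_0: "fps_nth (cross_fps a b1 b2) 0 = 0"
  by (simp add: cross_fps_def)

text \<open>Origin of the threshold a (a + 1): the first coefficients of F and G differ by h(b) = a
  b/((a + b)(a + b + 1)), and h(b2) - h(b1) has the sign of (b2 - b1)(a (a + 1) - b1 b2).\<close>

lemma cross_fps_nth_1: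
  "fps_nth (cross_fps a b1 b2) 1 = (b2 - b1) * (a * (a + 1) - b1 * b2) *
     (a / ((a + b1) * (a + b1 + 1) * ((a + b2) * (a + b2 + 1))))"
proof -
  have nz: "a + b1 > 0" "a + b2 > 0" "a + b1 + 1 > 0" "a + b2 + 1 > 0" using pos by auto
  have "fps_nth (cross_fps a b1 b2) 1 =
      a * b2 / (a + b2) + a * b1 / (a + b1 + 1) - (a * b2 / (a + b2 + 1) + a * b1 / (a + b1))"
    by (simp add: cross_fps_def fps_mult_nth_1 zbal_nth zbal1_nth)
  also have "\<dots> = (b2 - b1) * (a * (a + 1) - b1 * b2) *
     (a / ((a + b1) * (a + b1 + 1) * ((a + b2) * (a + b2 + 1))))"
  proof -
    have 1: "x / c - x / (c + 1) = x / (c * (c + 1))" if "c > 0" for c x :: real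
      using that by (simp add: divide_simps) (simp add: algebra_simps)
    have 2: "x / u - y / v = (x * v - y * u) / (u * v)" if "u > 0" "v > 0" for x y u v :: real
      using that by (simp add: divide_simps)
    have "a * b2 / (a + b2) + a * b1 / (a + b1 + 1) - (a * b2 / (a + b2 + 1) + a * b1 / (a + b1)) =
      a * b2 / ((a + b2) * (a + b2 + 1)) - a * b1 / ((a + b1) * (a + b1 + 1))"
      using 1[OF nz(1), of "a * b1"] 1[OF nz(2), of "a * b2"] by simp
    also have "\<dots> = (a * b2 * ((a + b1) * (a + b1 + 1)) - a * b1 * ((a + b2) * (a + b2 + 1))) /
        ((a + b2) * (a + b2 + 1) * ((a + b1) * (a + b1 + 1)))"
      using nz by (intro 2) auto
    also have "a * b2 * ((a + b1) * (a + b1 + 1)) - a * b1 * ((a + b2) * (a + b2 + 1)) =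
      (b2 - b1) * (a * (a + 1) - b1 * b2) * a"
      by (simp add: algebra_simps)
    finally show ?thesis by (simp add: mult_ac)
  qed
  finally show ?thesis .
qed

lemma cross_fps_deriv_0: "(eval_fps (cross_fps a b1 b2) has_real_derivative fps_nth (cross_fps a b1 b2) 1) (at 0)"
proof -
  have "(eval_fps (cross_fps a b1 b2) has_real_derivative eval_fps (fps_deriv (cross_fps a b1 b2)) 0) (at 0)"
    by (intro has_field_derivative_eval_fps less_fps_conv_radius cross_fps_conv_radius) simp
  thus ?thesis by (simp add: eval_fps_at_0)
qed

lemma Lambda2_less_1_near_0:
  assumes "b1 < b2" "b1 * b2 > a * (a + 1)"
  shows "\<exists>r4\<in>{0<..<1}. \<forall>r\<in>{0<..<r4}. Lambda2 a b1 b2 r < 1"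
proof -
  have "fps_nth (cross_fps a b1 b2) 1 < 0"
    unfolding cross_fps_nth_1 using assms pos by (intro mult_neg_pos mult_pos_neg divide_pos_pos mult_pos_pos) auto
  from DERIV_neg_dec_right[OF cross_fps_deriv_0 this] obtain d where
    d: "d > 0" "\<And>h. h > 0 \<Longrightarrow> h < d \<Longrightarrow> eval_fps (cross_fps a b1 b2) h < 0"
    by (auto simp: eval_fps_at_0 cross_fps_nth_0)
  show ?thesis
    by (rule bexI[of _ "min (d / 2) (1 / 2)"]) (use d in \<open>auto simp: Lambda2_gt_1_iff\<close>)
qed

lemma Lambda2_gt_1_near_0:
  assumes "b1 < b2" "b1 * b2 < a * (a + 1)"
  shows "\<exists>r5\<in>{0<..<1}. \<forall>r\<in>{0<..<r5}. Lambda2 a b1 b2 r > 1"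
proof -
  have "fps_nth (cross_fps a b1 b2) 1 > 0"
    unfolding cross_fps_nth_1 using assms pos by (intro mult_pos_pos divide_pos_pos) auto
  from DERIV_pos_inc_right[OF cross_fps_deriv_0 this] obtain d where
    d: "d > 0" "\<And>h. h > 0 \<Longrightarrow> h < d \<Longrightarrow> eval_fps (cross_fps a b1 b2) h > 0"
    by (auto simp: eval_fps_at_0 cross_fps_nth_0)
  show ?thesis
    by (rule bexI[of _ "min (d / 2) (1 / 2)"]) (use d in \<open>auto simp: Lambda2_gt_1_iff\<close>)
qed

end

section \<open>Limits as r -> 1 and as a -> 0, and the constant b_bar\<close>

lemma Lambda2_f4:
  assumes "a > 0" "b1 > 0" "0 < r" "r < 1"
  shows "Lambda2 a b1 b2 r = alpha_bar a b1 b2 - f4 a b1 b2 r / eval_fps (zbal a b1) r"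
  using eval_zbal_gt_1[OF assms] by (simp add: f4_def Lambda3_def hyp2F1_zbal diff_divide_distrib)

lemma inverse_zbal_tendsto:
  assumes "a > 0" "b > 0"
  shows "((\<lambda>r. k / eval_fps (zbal a b) r) \<longlongrightarrow> 0) (at_left 1)"
  by (rule real_tendsto_divide_at_top[OF tendsto_const eval_zbal_filterlim[OF assms]])

text \<open>\<open>f4\<close> has a finite limit while F_1 tends to infinity, so their quotient in
  \<open>Lambda2_f4\<close> vanishes.\<close>

lemma Lambda2_tendsto:
  assumes "a > 0" "0 < b1" "b1 \<le> b2"
  shows "(Lambda2 a b1 b2 \<longlongrightarrow> alpha_bar a b1 b2) (at_left 1)"
proof -
  have "((\<lambda>r. alpha_bar a b1 b2 - f4 a b1 b2 r / eval_fps (zbal a b1) r) \<longlongrightarrow> alpha_bar a b1 b2 - 0) (at_left 1)"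
    using assms by (intro tendsto_intros real_tendsto_divide_at_top[OF f4_tendsto eval_zbal_filterlim]) auto
  moreover have "\<forall>\<^sub>F r in at_left 1. alpha_bar a b1 b2 - f4 a b1 b2 r / eval_fps (zbal a b1) r = Lambda2 a b1 b2 r"
    using eventually_unit_at_left_1 by eventually_elim (use assms Lambda2_f4 in auto)
  ultimately show ?thesis using Lim_transform_eventually by fastforce
qed

lemma alpha_bar_gt_1:
  assumes "a > 0" "0 < b1" "b1 < b2"
  shows "alpha_bar a b1 b2 > 1"
proof -
  have "b1 * (a + b2) < b2 * (a + b1)" "b1 * (a + b2) > 0"
    using assms by (simp_all add: algebra_simps add_pos_pos)
  thus ?thesis by (simp add: alpha_bar_def)
qed

lemma Lambda2_gt_1_near_1:
  assumes "a > 0" "0 < b1" "b1 < b2"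
  shows "\<exists>r6\<in>{0<..<1}. \<forall>r\<in>{r6<..<1}. Lambda2 a b1 b2 r > 1"
proof -
  have "eventually (\<lambda>r. Lambda2 a b1 b2 r > 1) (at_left 1)"
    using order_tendstoD(1)[OF Lambda2_tendsto alpha_bar_gt_1] assms by auto
  then obtain c where c: "c < 1" "\<And>r. r > c \<Longrightarrow> r < 1 \<Longrightarrow> Lambda2 a b1 b2 r > 1"
    unfolding eventually_at_left_field by blast
  show ?thesis
    by (rule bexI[of _ "max c (1 / 2)"]) (use c in auto)
qed

text \<open>For 0 < a < 1 and n > 0 the n-th coefficient of F is at most a, since (a)_n/n! has first
  factor a and further factors (a + k)/(k + 1) \<le> 1. Hence 1 \<le> G \<le> F \<le> 1 + a/(1 -
  r).\<close>

lemma zbal_tendsto_a_0: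
  assumes "b > 0" "0 < r" "r < 1"
  shows "((\<lambda>a. eval_fps (zbal a b) r) \<longlongrightarrow> 1) (at_right 0)"
    and "((\<lambda>a. eval_fps (zbal1 a b) r) \<longlongrightarrow> 1) (at_right 0)"
proof -
  have ev: "eventually (\<lambda>a::real. 0 < a \<and> a < 1) (at_right 0)"
    using eventually_at_right_real[of 0 1] by simp
  have le: "eval_fps (zbal a b) r \<le> 1 + a * (1 / (1 - r))" if a: "0 < a" "a < 1" for a
  proof (rule sums_le)
    show "(\<lambda>n. fps_nth (zbal a b) n * r ^ n) sums eval_fps (zbal a b) r"
      using assms by (intro eval_zbal_sums a) auto
    show "(\<lambda>n. (if n = 0 then 1 else 0) + a * r ^ n) sums (1 + a * (1 / (1 - r)))"
      using sums_single[of 0 "\<lambda>_. 1 :: real"] assms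
      by (intro sums_add sums_mult geometric_sums) auto
    fix n
    show "fps_nth (zbal a b) n * r ^ n \<le> (if n = 0 then 1 else 0) + a * r ^ n"
    proof (cases n)
      case (Suc m)
      have "pochhammer a (Suc k) \<le> a * fact (Suc k)" for k
      proof (induction k)
        case (Suc k)
        have "pochhammer a (Suc (Suc k)) = (a + real (Suc k)) * pochhammer a (Suc k)"
          by (rule pochhammer_rec')
        also have "\<dots> \<le> real (Suc (Suc k)) * (a * fact (Suc k))"
          using a pochhammer_pos[of a "Suc k"] Suc by (intro mult_mono) auto
        finally show ?case by (simp add: mult_ac)
      qed (use a in simp)
      hence "pochhammer a n / fact n \<le> a"
        unfolding Suc by (simp add: pos_divide_le_eq del: pochhammer_Suc fact_Suc)
      moreover have "pochhammer b n / pochhammer (a + b) n \<le> 1"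
      proof -
        have "pochhammer (a + b) n > 0" using assms a by (intro pochhammer_pos) auto
        moreover have "pochhammer b n \<le> pochhammer (a + b) n"
          unfolding pochhammer_prod using assms a by (intro prod_mono) auto
        ultimately show ?thesis by simp
      qed
      ultimately have "(pochhammer a n / fact n) * (pochhammer b n / pochhammer (a + b) n) \<le> a * 1"
        using a assms pochhammer_pos[of b n] pochhammer_pos[of "a + b" n] by (intro mult_mono) auto
      hence "fps_nth (zbal a b) n \<le> a" by (simp add: zbal_nth mult_ac)
      thus ?thesis using assms Suc by (simp add: mult_right_mono)
    qed (use a in simp)
  qed
  have lim: "((\<lambda>a::real. 1 + a * (1 / (1 - r))) \<longlongrightarrow> 1) (at_right 0)"
    using assms by (auto intro!: tendsto_eq_intros)
  have ge: "1 \<le> eval_fps (zbal1 a b) r" "eval_fps (zbal1 a b) r \<le> eval_fps (zbal a b) r" if "0 < a" for a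
  proof -
    show "1 \<le> eval_fps (zbal1 a b) r" using assms that by (intro eval_zbal1_ge_1) auto
    show "eval_fps (zbal1 a b) r \<le> eval_fps (zbal a b) r"
      by (rule sums_le[OF _ eval_zbal1_sums eval_zbal_sums])
        (use that assms zbal1_nth_le_zbal in \<open>auto intro!: mult_right_mono\<close>)
  qed
  show "((\<lambda>a. eval_fps (zbal a b) r) \<longlongrightarrow> 1) (at_right 0)"
    by (rule tendsto_sandwich[OF _ _ tendsto_const[of 1] lim]; rule eventually_mono[OF ev])
      (use le ge in \<open>force\<close>)+
  show "((\<lambda>a. eval_fps (zbal1 a b) r) \<longlongrightarrow> 1) (at_right 0)"
    by (rule tendsto_sandwich[OF _ _ tendsto_const[of 1] lim]; rule eventually_mono[OF ev])
      (use le ge in \<open>force\<close>)+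
qed

text \<open>1/B(a,b1) contains the factor 1/Gamma(a); \<open>rGamma\<close> is continuous and
  vanishes at 0, where Gamma has a pole.\<close>

lemma beta_bar_tendsto:
  assumes "b1 > 0"
  shows "((\<lambda>a. beta_bar a b1 b2) \<longlongrightarrow> 0) (at_right 0)"
proof -
  have rG: "((\<lambda>a::real. rGamma a) \<longlongrightarrow> 0) (at_right 0)"
  proof -
    have "isCont (rGamma :: real \<Rightarrow> real) 0"
      using continuous_on_rGamma[of "UNIV :: real set"] by (simp add: continuous_on_eq_continuous_at)
    hence "((\<lambda>a::real. rGamma a) \<longlongrightarrow> rGamma 0) (at 0)" by (simp add: isCont_def)
    thus ?thesis by (auto intro: tendsto_within_subset)
  qed
  have b1: "b1 \<notin> \<int>\<^sub>\<le>\<^sub>0" using assms by (auto elim!: nonpos_Ints_cases)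
  have "((\<lambda>a. (Digamma b2 - Digamma b1) * (rGamma a * Gamma (a + b1) / Gamma b1)) \<longlongrightarrow>
      (Digamma b2 - Digamma b1) * (0 * Gamma (0 + b1) / Gamma b1)) (at_right 0)"
    using b1 Gamma_real_pos[OF assms] by (intro tendsto_intros rG) auto
  thus ?thesis
    by (simp add: beta_bar_def Beta_def rGamma_inverse_Gamma divide_inverse mult_ac)
qed

lemma alpha_bar_tendsto:
  assumes "b1 > 0" "b2 > 0"
  shows "((\<lambda>a. alpha_bar a b1 b2) \<longlongrightarrow> 1) (at_right 0)"
  unfolding alpha_bar_def using assms by (auto intro!: tendsto_eq_intros)

lemma eta_bar_tendsto:
  assumes "b1 > 0" "b2 > 0"
  shows "((\<lambda>a. eta_bar a b1 b2) \<longlongrightarrow> 0) (at_right 0)"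
  unfolding eta_bar_def using assms by (auto intro!: tendsto_eq_intros)

text \<open>With s = sqrt(a^2 - 1) the last root is (a + 1)/s, and the claim becomes s (a + 3) < (a
  + 1) sqrt(a^2 + 4 a - 1). The squares differ by exactly 8 (a + 1).\<close>

lemma b_bar_gt_1:
  assumes "a > 1"
  shows "b_bar a > 1"
proof -
  define s where "s = sqrt (a\<^sup>2 - 1)"
  have s2: "a\<^sup>2 - 1 > 0" using assms by (simp add: power2_eq_square less_1_mult)
  hence s: "s > 0" "s\<^sup>2 = a\<^sup>2 - 1" by (auto simp: s_def)
  have k: "sqrt ((a + 1) / (a - 1)) = (a + 1) / s"
  proof (rule real_sqrt_unique)
    have "((a + 1) / s)\<^sup>2 = (a + 1)\<^sup>2 / (a\<^sup>2 - 1)" by (simp add: power_divide s(2))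
    also have "a\<^sup>2 - 1 = (a - 1) * (a + 1)" by (simp add: power2_eq_square algebra_simps)
    also have "(a + 1)\<^sup>2 / ((a - 1) * (a + 1)) = (a + 1) / (a - 1)"
      using assms by (simp add: power2_eq_square)
    finally show "((a + 1) / s)\<^sup>2 = (a + 1) / (a - 1)" .
  qed (use assms s in auto)
  have nonneg: "a\<^sup>2 + 4 * a - 1 \<ge> 0" using s2 assms by linarith
  have "(s * (a + 3))\<^sup>2 < ((a + 1) * sqrt (a\<^sup>2 + 4 * a - 1))\<^sup>2"
  proof -
    have "((a + 1) * sqrt (a\<^sup>2 + 4 * a - 1))\<^sup>2 = (a + 1)\<^sup>2 * (a\<^sup>2 + 4 * a - 1)"
      using nonneg by (simp add: power_mult_distrib)
    also have "\<dots> = (a\<^sup>2 - 1) * (a + 3)\<^sup>2 + 8 * (a + 1)"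
      by (simp add: power2_eq_square algebra_simps)
    finally show ?thesis using assms by (simp add: power_mult_distrib s(2))
  qed
  moreover have "0 \<le> (a + 1) * sqrt (a\<^sup>2 + 4 * a - 1)" using assms nonneg by (simp del: diff_ge_0_iff_ge)
  ultimately have "s * (a + 3) < (a + 1) * sqrt (a\<^sup>2 + 4 * a - 1)"
    by (rule power2_less_imp_less)
  hence "2 * s < (sqrt (a\<^sup>2 + 4 * a - 1) - s) * (a + 1)" by (simp add: algebra_simps)
  thus ?thesis
    unfolding b_bar_def s_def[symmetric] k using s by (simp add: field_simps)
qed

section \<open>Bounds, best constants and limits\<close>

lemma alpha_bar_eta_bar:
  assumes "a > 0" "0 < b1" "0 < b2"
  shows "alpha_bar a b1 b2 * eta_bar a b1 b2 = a * (b2 - b1) / (b1 * (a + b2))"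
proof -
  have "a + b1 > 0" "a + b2 > 0" using assms by auto
  thus ?thesis using assms by (simp add: alpha_bar_def eta_bar_def divide_simps)
qed

lemma alpha_bar_pos: "a > 0 \<Longrightarrow> b1 > 0 \<Longrightarrow> b2 > 0 \<Longrightarrow> alpha_bar a b1 b2 > 0"
  by (simp add: alpha_bar_def)

lemma diagonal:
  assumes "a > 0" "b > 0"
  shows "alpha_bar a b b = 1" "beta_bar a b b = 0" "eta_bar a b b = 0"
  using assms by (auto simp: alpha_bar_def beta_bar_def eta_bar_def)

lemma hyp2F1_gt_1:
  assumes "a > 0" "b > 0" "r \<in> {0<..<1}"
  shows "hyp2F1 a b (a + b) r > 1"
  using eval_zbal_gt_1[of a b r] assms by (simp add: hyp2F1_zbal)

lemma Lambda3_conv_f4: "Lambda3 a b1 b2 r = alpha_bar a b1 b2 * hyp2F1 a b1 (a + b1) r - f4 a b1 b2 r"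
  by (simp add: f4_def)

lemma Lambda2_conv_f4:
  assumes "a > 0" "b1 > 0" "r \<in> {0<..<1}"
  shows "Lambda2 a b1 b2 r = alpha_bar a b1 b2 - f4 a b1 b2 r / hyp2F1 a b1 (a + b1) r"
  using Lambda2_f4[of a b1 r b2] assms by (simp add: hyp2F1_zbal)

lemma f4_diagonal:
  assumes "a > 0" "b > 0" "r \<in> {0<..<1}"
  shows "f4 a b b r = 0"
proof -
  have "eval_fps (zbal1 a b) r \<noteq> 0" using eval_zbal1_ge_1[of a b r] assms by auto
  thus ?thesis
    using Lambda3_altdef[of a b r b] assms by (simp add: f4_def diagonal hyp2F1_zbal)
qed

lemma Lambda3_compare_iff:
  assumes "a > 0" "b1 > 0" "r \<in> {0<..<1}"
  shows "Lambda3 a b1 b2 r > hyp2F1 a b1 (a + b1) r \<longleftrightarrow> Lambda2 a b1 b2 r > 1"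
    and "Lambda3 a b1 b2 r < hyp2F1 a b1 (a + b1) r \<longleftrightarrow> Lambda2 a b1 b2 r < 1"
  using hyp2F1_gt_1[OF assms] by (auto simp: Lambda3_def)

lemma f4_image:
  assumes "a > 0" "0 < b1" "b1 < b2"
  shows "f4 a b1 b2 ` {0<..<1} =
    {a * (b2 - b1) / (b1 * (a + b2)) <..< alpha_bar a b1 b2 * beta_bar a b1 b2}"
  using pos_power_series.image[OF f4_power_series[OF assms]] assms by (simp add: f4_fps_nth_0)

lemma f4_bounds:
  assumes "a > 0" "0 < b1" "b1 < b2" "r \<in> {0<..<1}"
  shows "alpha_bar a b1 b2 * eta_bar a b1 b2 < f4 a b1 b2 r"
    and "f4 a b1 b2 r < alpha_bar a b1 b2 * beta_bar a b1 b2"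
    and "0 < f4 a b1 b2 r"
proof -
  have "f4 a b1 b2 r \<in> {a * (b2 - b1) / (b1 * (a + b2)) <..< alpha_bar a b1 b2 * beta_bar a b1 b2}"
    unfolding f4_image[OF assms(1-3), symmetric] using assms(4) by (rule imageI)
  hence f: "a * (b2 - b1) / (b1 * (a + b2)) < f4 a b1 b2 r"
    "f4 a b1 b2 r < alpha_bar a b1 b2 * beta_bar a b1 b2" by simp_all
  show "alpha_bar a b1 b2 * eta_bar a b1 b2 < f4 a b1 b2 r"
    using f(1) assms by (simp add: alpha_bar_eta_bar)
  show "f4 a b1 b2 r < alpha_bar a b1 b2 * beta_bar a b1 b2" by (rule f(2))
  have "a * (b2 - b1) / (b1 * (a + b2)) > 0" using assms by simp
  thus "0 < f4 a b1 b2 r" using f(1) by (rule less_trans)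
qed

lemma Lambda_bounds_strict:
  assumes "a > 0" "0 < b1" "b1 < b2" "r \<in> {0<..<1}"
  defines "F \<equiv> hyp2F1 a b1 (a + b1) r" and "\<alpha> \<equiv> alpha_bar a b1 b2" and "\<beta> \<equiv> beta_bar a b1 b2"
    and "\<eta> \<equiv> eta_bar a b1 b2" and "L2 \<equiv> Lambda2 a b1 b2 r" and "L3 \<equiv> Lambda3 a b1 b2 r"
  shows "\<alpha> * (F - \<beta>) < L3" "L3 < \<alpha> * (F - \<eta>)"
    "\<alpha> * (1 - \<beta> / F) < L2" "L2 < \<alpha> * (1 - \<eta> / F)"
    "\<alpha> * (1 - \<beta>) < L2" "L2 < \<alpha>"
proof -
  define f where "f = f4 a b1 b2 r"
  have F: "F > 1" unfolding F_def using assms by (intro hyp2F1_gt_1)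
  have f: "\<alpha> * \<eta> < f" "f < \<alpha> * \<beta>" "0 < f"
    using f4_bounds[OF assms(1-4)] by (auto simp: f_def \<alpha>_def \<beta>_def \<eta>_def)
  have L3: "L3 = \<alpha> * F - f" by (simp add: L3_def Lambda3_conv_f4 F_def \<alpha>_def f_def)
  have L2: "L2 = \<alpha> - f / F"
    using assms by (simp add: L2_def Lambda2_conv_f4 F_def \<alpha>_def f_def)
  show "\<alpha> * (F - \<beta>) < L3" "L3 < \<alpha> * (F - \<eta>)"
    using f by (simp_all add: L3 right_diff_distrib)
  have "f / F < \<alpha> * \<beta> / F" "\<alpha> * \<eta> / F < f / F"
    using f F by (simp_all add: divide_strict_right_mono)
  thus "\<alpha> * (1 - \<beta> / F) < L2" "L2 < \<alpha> * (1 - \<eta> / F)"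
    by (simp_all add: L2 right_diff_distrib)
  have "f / F < f" "f / F > 0" using f F by (simp_all add: divide_less_eq)
  with f show "\<alpha> * (1 - \<beta>) < L2" "L2 < \<alpha>" by (simp_all add: L2 right_diff_distrib)
qed

lemma one_minus_quotient_tendsto:
  assumes "a > 0" "b > 0"
  shows "((\<lambda>r. k * (1 - c / hyp2F1 a b (a + b) r)) \<longlongrightarrow> k) (at_left 1)"
proof -
  have "((\<lambda>r. k * (1 - c / hyp2F1 a b (a + b) r)) \<longlongrightarrow> k * (1 - 0)) (at_left 1)"
    unfolding hyp2F1_zbal by (intro tendsto_intros inverse_zbal_tendsto assms)
  thus ?thesis by simp
qed

text \<open>The limits at r -> 1 settle \<alpha> (L2 tends to \<alpha> and F to infinity) and
  \<beta> (\<open>f4\<close> tends to \<alpha> \<beta>). For \<eta> the range of \<open>f4\<close>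
  is used, whose lower end is \<alpha> \<eta>. The free constant c gives the coefficient \<alpha> in
  (B) and, with c = 0, the upper bound in (C).\<close>

lemma best_constants:
  assumes "a > 0" "0 < b1" "b1 \<le> b2"
  defines "F \<equiv> hyp2F1 a b1 (a + b1)" and "\<alpha> \<equiv> alpha_bar a b1 b2" and "\<beta> \<equiv> beta_bar a b1 b2"
    and "\<eta> \<equiv> eta_bar a b1 b2" and "L2 \<equiv> Lambda2 a b1 b2"
  shows "(\<And>r. r \<in> {0<..<1} \<Longrightarrow> \<alpha>' * (1 - c / F r) \<le> L2 r) \<Longrightarrow> \<alpha>' \<le> \<alpha>"
    and "(\<And>r. r \<in> {0<..<1} \<Longrightarrow> \<alpha> * (1 - \<beta>' / F r) \<le> L2 r) \<Longrightarrow> \<beta> \<le> \<beta>'"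
    and "(\<And>r. r \<in> {0<..<1} \<Longrightarrow> L2 r \<le> \<alpha>' * (1 - c / F r)) \<Longrightarrow> \<alpha> \<le> \<alpha>'"
    and "(\<And>r. r \<in> {0<..<1} \<Longrightarrow> L2 r \<le> \<alpha> * (1 - \<eta>' / F r)) \<Longrightarrow> \<eta>' \<le> \<eta>"
proof -
  have b2: "b2 > 0" using assms by simp
  have \<alpha>: "\<alpha> > 0" unfolding \<alpha>_def using assms b2 by (intro alpha_bar_pos)
  have L2: "(L2 \<longlongrightarrow> \<alpha>) (at_left 1)"
    unfolding L2_def \<alpha>_def by (rule Lambda2_tendsto[OF assms(1-3)])
  have F: "((\<lambda>r. k * (1 - c / F r)) \<longlongrightarrow> k) (at_left 1)" for k c
    unfolding F_def by (rule one_minus_quotient_tendsto[OF assms(1,2)])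
  \<comment> \<open>Since L2 = \<alpha> - f4/F, bounds of shape (B) with leading coefficient
    \<alpha> are exactly constant bounds on \<open>f4\<close>.\<close>
  have f4_eq: "\<alpha> * (1 - x / F r) \<le> L2 r \<longleftrightarrow> f4 a b1 b2 r \<le> \<alpha> * x"
      "L2 r \<le> \<alpha> * (1 - x / F r) \<longleftrightarrow> \<alpha> * x \<le> f4 a b1 b2 r" if r: "r \<in> {0<..<1}" for r x
  proof -
    have "F r > 0" using hyp2F1_gt_1[OF assms(1,2) r] by (simp add: F_def)
    moreover have "L2 r = \<alpha> - f4 a b1 b2 r / F r"
      using Lambda2_conv_f4[OF assms(1,2) r] by (simp add: L2_def F_def \<alpha>_def)
    ultimately show "\<alpha> * (1 - x / F r) \<le> L2 r \<longleftrightarrow> f4 a b1 b2 r \<le> \<alpha> * x"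
      "L2 r \<le> \<alpha> * (1 - x / F r) \<longleftrightarrow> \<alpha> * x \<le> f4 a b1 b2 r"
      by (simp_all add: right_diff_distrib divide_le_cancel)
  qed
  show "\<alpha>' \<le> \<alpha>" if "\<And>r. r \<in> {0<..<1} \<Longrightarrow> \<alpha>' * (1 - c / F r) \<le> L2 r"
    by (rule tendsto_le[OF _ L2 F[of \<alpha>' c]]) (use that in \<open>auto intro: eventually_mono[OF eventually_unit_at_left_1]\<close>)
  show "\<alpha> \<le> \<alpha>'" if "\<And>r. r \<in> {0<..<1} \<Longrightarrow> L2 r \<le> \<alpha>' * (1 - c / F r)"
    by (rule tendsto_le[OF _ F[of \<alpha>' c] L2]) (use that in \<open>auto intro: eventually_mono[OF eventually_unit_at_left_1]\<close>)
  show "\<beta> \<le> \<beta>'" if "\<And>r. r \<in> {0<..<1} \<Longrightarrow> \<alpha> * (1 - \<beta>' / F r) \<le> L2 r"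
  proof -
    have "\<alpha> * \<beta> \<le> \<alpha> * \<beta>'"
      unfolding \<alpha>_def \<beta>_def
    proof (rule tendsto_upperbound[OF f4_tendsto[OF assms(1-3)]])
      show "\<forall>\<^sub>F r in at_left 1. f4 a b1 b2 r \<le> alpha_bar a b1 b2 * \<beta>'"
        by (rule eventually_mono[OF eventually_unit_at_left_1]) (use that f4_eq in \<open>simp add: \<alpha>_def\<close>)
    qed simp
    thus ?thesis using \<alpha> by simp
  qed
  show "\<eta>' \<le> \<eta>" if "\<And>r. r \<in> {0<..<1} \<Longrightarrow> L2 r \<le> \<alpha> * (1 - \<eta>' / F r)"
  proof (rule ccontr)
    assume neg: "\<not> \<eta>' \<le> \<eta>"
    have le: "\<alpha> * \<eta>' \<le> f4 a b1 b2 r" if "r \<in> {0<..<1}" for r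
      using \<open>\<And>r. r \<in> {0<..<1} \<Longrightarrow> L2 r \<le> \<alpha> * (1 - \<eta>' / F r)\<close>[OF that] f4_eq(2)[OF that] by simp
    show False
    proof (cases "b1 = b2")
      case True
      have "\<alpha> * \<eta>' \<le> 0"
        using le[of "1 / 2"] f4_diagonal[of a b1 "1 / 2"] assms(1,2) True by simp
      moreover have "\<eta> = 0" using assms True by (simp add: diagonal)
      ultimately show False using neg \<alpha> by (simp add: mult_le_0_iff)
    next
      case False
      hence lt: "b1 < b2" using assms by simp
      have "\<alpha> * \<eta> < \<alpha> * \<eta>'" using neg \<alpha> by simp
      moreover have "\<alpha> * \<eta> < \<alpha> * \<beta>"
        using f4_bounds(1,2)[OF assms(1,2) lt, of "1 / 2"] by (simp add: \<alpha>_def \<beta>_def \<eta>_def)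
      \<comment> \<open>y lies strictly between the infimum \<alpha> \<eta> of \<open>f4\<close> and
        the alleged lower bound \<alpha> \<eta>'; staying below \<alpha> \<beta> makes it a value of
        \<open>f4\<close>.\<close>
      ultimately obtain y where y: "\<alpha> * \<eta> < y" "y < \<alpha> * \<eta>'" "y < \<alpha> * \<beta>"
        using dense[of "\<alpha> * \<eta>" "min (\<alpha> * \<eta>') (\<alpha> * \<beta>)"] by auto
      hence "y \<in> f4 a b1 b2 ` {0<..<1}"
        unfolding f4_image[OF assms(1,2) lt] alpha_bar_eta_bar[OF assms(1,2) b2, symmetric]
        by (simp add: \<alpha>_def \<beta>_def \<eta>_def)
      with le y(2) show False by fastforce
    qed
  qed
qed

lemma Lambda2_tendsto_a_0:
  assumes "b1 > 0" "b2 > 0" "r \<in> {0<..<1}"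
  shows "((\<lambda>a. hyp2F1 a b1 (a + b1) r) \<longlongrightarrow> 1) (at_right 0)"
    and "((\<lambda>a. Lambda2 a b1 b2 r) \<longlongrightarrow> 1) (at_right 0)"
    and "((\<lambda>a. Lambda3 a b1 b2 r) \<longlongrightarrow> 1) (at_right 0)"
proof -
  have r: "0 < r" "r < 1" using assms by auto
  show F: "((\<lambda>a. hyp2F1 a b1 (a + b1) r) \<longlongrightarrow> 1) (at_right 0)"
    unfolding hyp2F1_zbal by (rule zbal_tendsto_a_0(1)[OF assms(1) r])
  have "((\<lambda>a. Lambda2 a b1 b2 r) \<longlongrightarrow> 1 * 1 / (1 * 1)) (at_right 0)"
    unfolding Lambda2_altdef by (intro tendsto_intros zbal_tendsto_a_0 assms r) auto
  thus L2: "((\<lambda>a. Lambda2 a b1 b2 r) \<longlongrightarrow> 1) (at_right 0)" by simp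
  have "((\<lambda>a. Lambda3 a b1 b2 r) \<longlongrightarrow> 1 * 1) (at_right 0)"
    unfolding Lambda3_def by (intro tendsto_mult F L2)
  thus "((\<lambda>a. Lambda3 a b1 b2 r) \<longlongrightarrow> 1) (at_right 0)" by simp
qed

section \<open>The derivative in b of the quotient in statement (1)\<close>

lemma hyp2F1_quotient_differentiable:
  assumes "a > 0" "b > 0" "r \<in> {0<..<1}"
  shows "(\<lambda>b. hyp2F1 (a + 1) (b + 1) (a + b + 1) r / hyp2F1 a b (a + b) r) differentiable (at b)"
proof -
  have 1: "(\<lambda>x. hyp2F1 (a + 1) x (x + a) r) differentiable (at (b + 1))"
    by (rule hyp2F1_differentiable) (use assms in auto)
  have "(\<lambda>x::real. x + 1) differentiable (at b)" by simp
  from differentiable_compose[OF 1 this]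
  have "(\<lambda>b. hyp2F1 (a + 1) (b + 1) (a + b + 1) r) differentiable (at b)"
    by (simp add: add_ac)
  moreover have "(\<lambda>b. hyp2F1 a b (a + b) r) differentiable (at b)"
    using hyp2F1_differentiable[of a a r b] assms by (simp add: add_ac)
  ultimately show ?thesis
    by (rule differentiable_divide) (use hyp2F1_gt_1[OF assms] in auto)
qed

text \<open>\<open>Lambda2\<close> is G/F at b1 divided by G/F at b2, and Euler's factor 1 - r does
  not depend on b. A negative derivative in b would therefore give \<open>Lambda2\<close> > 1 at
  every r, against \<open>Lambda2_less_1_near_0\<close>.\<close>

lemma hyp2F1_quotient_deriv_not_neg:
  assumes "a > 0" "0 < b1" "b1 < b2" "b1 * b2 > a * (a + 1)"
  shows "\<not> (\<forall>b>0. \<forall>r\<in>{0<..<1}.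
    deriv (\<lambda>b. hyp2F1 (a + 1) (b + 1) (a + b + 1) r / hyp2F1 a b (a + b) r) b < 0)"
proof
  assume neg: "\<forall>b>0. \<forall>r\<in>{0<..<1}.
    deriv (\<lambda>b. hyp2F1 (a + 1) (b + 1) (a + b + 1) r / hyp2F1 a b (a + b) r) b < 0"
  have b2: "b2 > 0" using assms by simp
  obtain r4 where r4: "r4 \<in> {0<..<1}" "\<And>r. r \<in> {0<..<r4} \<Longrightarrow> Lambda2 a b1 b2 r < 1"
    using Lambda2_less_1_near_0[OF assms(1,2) b2 assms(3,4)] by blast
  define r where "r = r4 / 2"
  have r: "r \<in> {0<..<1}" "0 < r" "r < 1" "Lambda2 a b1 b2 r < 1" using r4 by (auto simp: r_def)
  let ?q = "\<lambda>b. hyp2F1 (a + 1) (b + 1) (a + b + 1) r / hyp2F1 a b (a + b) r"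
  have q: "?q b * (1 - r) = eval_fps (zbal1 a b) r / eval_fps (zbal a b) r" if "b > 0" for b
    unfolding hyp2F1_euler[OF assms(1) that r(2,3)] hyp2F1_zbal using r by simp
  have "?q b1 > ?q b2"
  proof (rule DERIV_neg_imp_decreasing[OF assms(3)])
    fix b assume "b1 \<le> b" "b \<le> b2"
    hence b: "b > 0" using assms by simp
    with neg r have "deriv ?q b < 0" by blast
    moreover have "(?q has_real_derivative deriv ?q b) (at b)"
      using hyp2F1_quotient_differentiable[OF assms(1) b r(1)]
      by (simp only: DERIV_deriv_iff_real_differentiable)
    ultimately show "\<exists>y. (?q has_real_derivative y) (at b) \<and> y < 0" by blast
  qed
  hence "?q b2 * (1 - r) < ?q b1 * (1 - r)" using r by (intro mult_strict_right_mono) auto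
  hence "eval_fps (zbal1 a b2) r / eval_fps (zbal a b2) r < eval_fps (zbal1 a b1) r / eval_fps (zbal a b1) r"
    unfolding q[OF b2] q[OF assms(2)] .
  moreover have "eval_fps (zbal a b1) r > 0" "eval_fps (zbal a b2) r > 0" "eval_fps (zbal1 a b2) r > 0"
    using eval_zbal_gt_1[OF assms(1,2) r(2,3)] eval_zbal_gt_1[OF assms(1) b2 r(2,3)]
      eval_zbal1_ge_1[OF assms(1) b2, of r] r by auto
  ultimately have "Lambda2 a b1 b2 r > 1"
    unfolding Lambda2_altdef by (simp add: divide_less_eq less_divide_eq mult_ac)
  with r show False by simp
qed

lemma f4_partial_sums:
  fixes n :: nat
  assumes "a > 0" "0 < b1" "b1 < b2" "r \<in> {0<..<1}"
  defines "bt \<equiv> fps_nth (f4_fps a b1 b2)"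
    and "F \<equiv> hyp2F1 a b1 (a + b1) r" and "\<alpha> \<equiv> alpha_bar a b1 b2" and "\<beta> \<equiv> beta_bar a b1 b2"
    and "L2 \<equiv> Lambda2 a b1 b2 r" and "L3 \<equiv> Lambda3 a b1 b2 r"
  defines "\<eta>n \<equiv> \<alpha> * \<beta> - (\<Sum>k=0..n+1. bt k)"
  defines "lower \<equiv> (\<Sum>k=0..n+2. bt k * r ^ k)"
    and "upper \<equiv> (\<Sum>k=0..n+1. bt k * r ^ k) + \<eta>n * r ^ (n + 2)"
  shows "lower < \<alpha> * F - L3" "\<alpha> * F - L3 < upper" "\<alpha> * (1 - \<beta>) < \<alpha> - upper / F"
    "\<alpha> - upper / F < L2" "L2 < \<alpha> - lower / F" "\<alpha> - lower / F < \<alpha>"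
proof -
  interpret pos_power_series "f4_fps a b1 b2" "f4 a b1 b2" "\<alpha> * \<beta>"
    unfolding \<alpha>_def \<beta>_def by (rule f4_power_series[OF assms(1-3)])
  have r: "0 < r" "r < 1" using assms by auto
  define f where "f = f4 a b1 b2 r"
  have F: "F > 1" unfolding F_def using assms by (intro hyp2F1_gt_1)
  have L3: "\<alpha> * F - L3 = f" by (simp add: L3_def Lambda3_conv_f4 F_def \<alpha>_def f_def)
  have L2: "L2 = \<alpha> - f / F"
    using assms by (simp add: L2_def Lambda2_conv_f4 F_def \<alpha>_def f_def)
  have lower: "lower < f"
    unfolding lower_def f_def bt_def by (rule partial_sum_less[OF r])
  \<comment> \<open>The locale lemmas are taken at n + 1, whose correction term carries the power n
    + 2.\<close>
  have upper: "f < upper" "upper \<le> \<alpha> * \<beta>"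
    using less_partial_sum_plus[OF r, of "n + 1"] partial_sum_plus_le[OF r, of "n + 1"]
    by (simp_all add: upper_def f_def \<eta>n_def bt_def)
  have lower_pos: "lower > 0"
    unfolding lower_def bt_def using coeff_pos r by (intro sum_pos) auto
  show "lower < \<alpha> * F - L3" "\<alpha> * F - L3 < upper" using lower upper L3 by simp_all
  show "\<alpha> - upper / F < L2" "L2 < \<alpha> - lower / F"
    using lower upper F by (simp_all add: L2 divide_strict_right_mono)
  show "\<alpha> - lower / F < \<alpha>" using lower_pos F by simp
  have "upper > 0" using lower lower_pos upper by linarith
  hence "upper / F < upper" using F by (simp add: divide_less_eq)
  with upper show "\<alpha> * (1 - \<beta>) < \<alpha> - upper / F" by (simp add: right_diff_distrib)
qed

theorem theorem1p2:
  shows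
  "\<comment> \<open>(1)\<close>
   (\<forall>a>0. \<forall>b1>0. \<forall>b2>b1.
      (\<forall>r\<in>{0<..<1}. Lambda2 a b1 b2 r > 1 \<longleftrightarrow> Lambda3 a b1 b2 r > hyp2F1 a b1 (a + b1) r) \<and>
      (b1 * b2 > a * (a + 1) \<longrightarrow>
         \<not> (\<forall>r\<in>{0<..<1}. Lambda2 a b1 b2 r > 1) \<and>
         \<not> (\<forall>r\<in>{0<..<1}. Lambda3 a b1 b2 r > hyp2F1 a b1 (a + b1) r))) \<and>
   (\<forall>a>0. \<forall>b>0. \<forall>r\<in>{0<..<1}.
      (\<lambda>b. hyp2F1 (a + 1) (b + 1) (a + b + 1) r / hyp2F1 a b (a + b) r) differentiable (at b)) \<and>
   \<not> (\<forall>a>0. \<forall>b>0. \<forall>r\<in>{0<..<1}.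
        deriv (\<lambda>b. hyp2F1 (a + 1) (b + 1) (a + b + 1) r / hyp2F1 a b (a + b) r) b < 0) \<and>
   \<comment> \<open>(2)\<close>
   (\<forall>a>0. \<forall>b1>0. \<forall>b2>b1.
      (b1 * b2 > a * (a + 1) \<longrightarrow>
         (\<exists>r4\<in>{0<..<1}. \<forall>r\<in>{0<..<r4}. Lambda2 a b1 b2 r < 1)) \<and>
      (b1 * b2 < a * (a + 1) \<longrightarrow>
         (\<exists>r5\<in>{0<..<1}. \<forall>r\<in>{0<..<r5}. Lambda2 a b1 b2 r > 1)) \<and>
      (\<exists>r6\<in>{0<..<1}. \<forall>r\<in>{r6<..<1}. Lambda2 a b1 b2 r > 1)) \<and>
   \<not> (\<forall>a>0. \<forall>b1>0. \<forall>b2>b1. \<forall>r\<in>{0<..<1}. Lambda2 a b1 b2 r > 1) \<and>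
   \<not> (\<forall>a>0. \<forall>b1>0. \<forall>b2>b1. \<forall>r\<in>{0<..<1}. Lambda2 a b1 b2 r < 1) \<and>
   \<not> (\<forall>a>0. \<forall>b1>0. \<forall>b2>b1. \<forall>r\<in>{0<..<1}.
        Lambda3 a b1 b2 r > hyp2F1 a b1 (a + b1) r) \<and>
   \<not> (\<forall>a>0. \<forall>b1>0. \<forall>b2>b1. \<forall>r\<in>{0<..<1}.
        Lambda3 a b1 b2 r < hyp2F1 a b1 (a + b1) r) \<and>
   \<comment> \<open>(3): monotonicity and range of f4\<close>
   (\<forall>a>0. \<forall>b1>0. \<forall>b2>b1.
      strict_mono_on {0<..<1} (f4 a b1 b2) \<and>
      f4 a b1 b2 ` {0<..<1} =
        {a * (b2 - b1) / (b1 * (a + b2)) <..< alpha_bar a b1 b2 * beta_bar a b1 b2}) \<and>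
   \<comment> \<open>(3): the inequalities (A), (B), (C) with their equality cases\<close>
   (\<forall>a>0. \<forall>b1>0. \<forall>b2\<ge>b1. \<forall>r\<in>{0<..<1}.
      let F = hyp2F1 a b1 (a + b1) r; \<alpha> = alpha_bar a b1 b2; \<beta> = beta_bar a b1 b2;
          \<eta> = eta_bar a b1 b2; L2 = Lambda2 a b1 b2 r; L3 = Lambda3 a b1 b2 r
      in
        \<alpha> * (F - \<beta>) \<le> L3 \<and> L3 \<le> \<alpha> * (F - \<eta>) \<and>
        \<alpha> * (1 - \<beta> / F) \<le> L2 \<and> L2 \<le> \<alpha> * (1 - \<eta> / F) \<and>
        \<alpha> * (1 - \<beta>) \<le> L2 \<and> L2 \<le> \<alpha> \<and>
        (\<alpha> * (F - \<beta>) = L3 \<longleftrightarrow> b1 = b2) \<and> (L3 = \<alpha> * (F - \<eta>) \<longleftrightarrow> b1 = b2) \<and>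
        (\<alpha> * (1 - \<beta> / F) = L2 \<longleftrightarrow> b1 = b2) \<and> (L2 = \<alpha> * (1 - \<eta> / F) \<longleftrightarrow> b1 = b2) \<and>
        (\<alpha> * (1 - \<beta>) = L2 \<longleftrightarrow> b1 = b2) \<and> (L2 = \<alpha> \<longleftrightarrow> b1 = b2)) \<and>
   \<comment> \<open>(3): best possible constants, and sharpness of (B) as r tends to 1\<close>
   (\<forall>a>0. \<forall>b1>0. \<forall>b2\<ge>b1.
      let F = hyp2F1 a b1 (a + b1); \<alpha> = alpha_bar a b1 b2; \<beta> = beta_bar a b1 b2;
          \<eta> = eta_bar a b1 b2; L2 = Lambda2 a b1 b2; L3 = Lambda3 a b1 b2
      in
        (\<forall>\<alpha>'. (\<forall>r\<in>{0<..<1}. \<alpha>' * (F r - \<beta>) \<le> L3 r) \<longrightarrow> \<alpha>' \<le> \<alpha>) \<and>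
        (\<forall>\<beta>'. (\<forall>r\<in>{0<..<1}. \<alpha> * (F r - \<beta>') \<le> L3 r) \<longrightarrow> \<beta> \<le> \<beta>') \<and>
        (\<forall>\<alpha>'. (\<forall>r\<in>{0<..<1}. L3 r \<le> \<alpha>' * (F r - \<eta>)) \<longrightarrow> \<alpha> \<le> \<alpha>') \<and>
        (\<forall>\<eta>'. (\<forall>r\<in>{0<..<1}. L3 r \<le> \<alpha> * (F r - \<eta>')) \<longrightarrow> \<eta>' \<le> \<eta>) \<and>
        (\<forall>\<alpha>'. (\<forall>r\<in>{0<..<1}. \<alpha>' * (1 - \<beta> / F r) \<le> L2 r) \<longrightarrow> \<alpha>' \<le> \<alpha>) \<and>
        (\<forall>\<beta>'. (\<forall>r\<in>{0<..<1}. \<alpha> * (1 - \<beta>' / F r) \<le> L2 r) \<longrightarrow> \<beta> \<le> \<beta>') \<and>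
        (\<forall>\<alpha>'. (\<forall>r\<in>{0<..<1}. L2 r \<le> \<alpha>' * (1 - \<eta> / F r)) \<longrightarrow> \<alpha> \<le> \<alpha>') \<and>
        (\<forall>\<eta>'. (\<forall>r\<in>{0<..<1}. L2 r \<le> \<alpha> * (1 - \<eta>' / F r)) \<longrightarrow> \<eta>' \<le> \<eta>) \<and>
        (\<forall>\<alpha>'. (\<forall>r\<in>{0<..<1}. L2 r \<le> \<alpha>') \<longrightarrow> \<alpha> \<le> \<alpha>') \<and>
        (\<exists>l. ((\<lambda>r. \<alpha> * (1 - \<beta> / F r)) \<longlongrightarrow> l) (at_left 1) \<and>
             (L2 \<longlongrightarrow> l) (at_left 1) \<and>
             ((\<lambda>r. \<alpha> * (1 - \<eta> / F r)) \<longlongrightarrow> l) (at_left 1))) \<and>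
   \<comment> \<open>(3): sharpness of (A), (B), (C) as a tends to 0\<close>
   (\<forall>b1>0. \<forall>b2\<ge>b1. \<forall>r\<in>{0<..<1}.
      let F = (\<lambda>a. hyp2F1 a b1 (a + b1) r); \<alpha> = (\<lambda>a. alpha_bar a b1 b2);
          \<beta> = (\<lambda>a. beta_bar a b1 b2); \<eta> = (\<lambda>a. eta_bar a b1 b2);
          L2 = (\<lambda>a. Lambda2 a b1 b2 r); L3 = (\<lambda>a. Lambda3 a b1 b2 r)
      in
        (\<exists>l. ((\<lambda>a. \<alpha> a * (F a - \<beta> a)) \<longlongrightarrow> l) (at_right 0) \<and>
             (L3 \<longlongrightarrow> l) (at_right 0) \<and>
             ((\<lambda>a. \<alpha> a * (F a - \<eta> a)) \<longlongrightarrow> l) (at_right 0)) \<and>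
        (\<exists>l. ((\<lambda>a. \<alpha> a * (1 - \<beta> a / F a)) \<longlongrightarrow> l) (at_right 0) \<and>
             (L2 \<longlongrightarrow> l) (at_right 0) \<and>
             ((\<lambda>a. \<alpha> a * (1 - \<eta> a / F a)) \<longlongrightarrow> l) (at_right 0)) \<and>
        (\<exists>l. ((\<lambda>a. \<alpha> a * (1 - \<beta> a)) \<longlongrightarrow> l) (at_right 0) \<and>
             (L2 \<longlongrightarrow> l) (at_right 0) \<and>
             (\<alpha> \<longlongrightarrow> l) (at_right 0))) \<and>
   \<comment> \<open>(4)\<close>
   (\<forall>a>1. b_bar a > 1) \<and>
   (\<forall>a>0. \<forall>b1>0. \<forall>b2>b1.
      \<exists>bt :: nat \<Rightarrow> real.
        (\<forall>r\<in>{0<..<1}. (\<lambda>k. bt k * r ^ k) sums f4 a b1 b2 r) \<and>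
        (a \<le> 1 \<or> (a > 1 \<and> b2 \<le> b_bar a) \<longrightarrow>
          absolutely_monotone_on (f4 a b1 b2) {0<..<1} \<and>
          f4 a b1 b2 ` {0<..<1} =
            {a * (b2 - b1) / (b1 * (a + b2)) <..< alpha_bar a b1 b2 * beta_bar a b1 b2} \<and>
          (\<forall>n. \<forall>r\<in>{0<..<1}.
            let F = hyp2F1 a b1 (a + b1) r; \<alpha> = alpha_bar a b1 b2; \<beta> = beta_bar a b1 b2;
                L2 = Lambda2 a b1 b2 r; L3 = Lambda3 a b1 b2 r;
                \<eta>n = \<alpha> * \<beta> - (\<Sum>k=0..n+1. bt k);
                lower = (\<Sum>k=0..n+2. bt k * r ^ k);
                upper = (\<Sum>k=0..n+1. bt k * r ^ k) + \<eta>n * r ^ (n + 2)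
            in
              lower < \<alpha> * F - L3 \<and> \<alpha> * F - L3 < upper \<and>
              \<alpha> * (1 - \<beta>) < \<alpha> - upper / F \<and> \<alpha> - upper / F < L2 \<and>
              L2 < \<alpha> - lower / F \<and> \<alpha> - lower / F < \<alpha>)))"
proof -
  \<comment> \<open>b1 b2 = 6 exceeds a (a + 1) = 2. For this one triple \<open>Lambda2\<close> is
    below 1 near 0 and above 1 near 1, which refutes every universal inequality in (1) and
    (2).\<close>
  obtain a b1 b2 :: real where pos: "a > 0" "b1 > 0" "b1 < b2" and below: "b1 * b2 > a * (a + 1)"
    by (rule that[of 1 2 3]) simp_all
  obtain r1 r2 where rs: "r1 \<in> {0<..<1}" "r2 \<in> {0<..<1}"
      "Lambda2 a b1 b2 r1 < 1" "Lambda2 a b1 b2 r2 > 1"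
  proof -
    obtain r4 where r4: "r4 \<in> {0<..<1}" "\<And>r. r \<in> {0<..<r4} \<Longrightarrow> Lambda2 a b1 b2 r < 1"
      using Lambda2_less_1_near_0[of a b1 b2] pos below by auto
    obtain r6 where r6: "r6 \<in> {0<..<1}" "\<And>r. r \<in> {r6<..<1} \<Longrightarrow> Lambda2 a b1 b2 r > 1"
      using Lambda2_gt_1_near_1[OF pos] by auto
    show ?thesis by (rule that[of "r4 / 2" "(r6 + 1) / 2"]) (use r4 r6 in auto)
  qed
  show ?thesis
  proof (intro conjI, goal_cases)
  case 1
  show ?case
  proof (intro allI impI conjI ballI)
    fix a b1 b2 :: real assume pos: "a > 0" "b1 > 0" "b1 < b2"
    show iff: "Lambda2 a b1 b2 r > 1 \<longleftrightarrow> Lambda3 a b1 b2 r > hyp2F1 a b1 (a + b1) r" if "r \<in> {0<..<1}" for r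
      using Lambda3_compare_iff(1)[OF pos(1,2) that] by simp
    assume "b1 * b2 > a * (a + 1)"
    then obtain r4 where r4: "r4 \<in> {0<..<1}" "\<And>r. r \<in> {0<..<r4} \<Longrightarrow> Lambda2 a b1 b2 r < 1"
      using Lambda2_less_1_near_0[of a b1 b2] pos by auto
    hence *: "r4 / 2 \<in> {0<..<1}" "Lambda2 a b1 b2 (r4 / 2) < 1" by auto
    thus "\<not> (\<forall>r\<in>{0<..<1}. Lambda2 a b1 b2 r > 1)" by (meson less_asym)
    with iff show "\<not> (\<forall>r\<in>{0<..<1}. Lambda3 a b1 b2 r > hyp2F1 a b1 (a + b1) r)" by blast
  qed
next
  case 2
  show ?case using hyp2F1_quotient_differentiable by blast
next
  case 3
  show ?case using hyp2F1_quotient_deriv_not_neg[OF pos(1-3) below] pos by blast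
next
  case 4
  show ?case
  proof (intro allI impI conjI)
    fix a b1 b2 :: real assume pos: "a > 0" "b1 > 0" "b1 < b2"
    hence b2: "b2 > 0" by simp
    show "\<exists>r4\<in>{0<..<1}. \<forall>r\<in>{0<..<r4}. Lambda2 a b1 b2 r < 1" if "b1 * b2 > a * (a + 1)"
      by (rule Lambda2_less_1_near_0[OF pos(1,2) b2 pos(3) that])
    show "\<exists>r5\<in>{0<..<1}. \<forall>r\<in>{0<..<r5}. Lambda2 a b1 b2 r > 1" if "b1 * b2 < a * (a + 1)"
      by (rule Lambda2_gt_1_near_0[OF pos(1,2) b2 pos(3) that])
    show "\<exists>r6\<in>{0<..<1}. \<forall>r\<in>{r6<..<1}. Lambda2 a b1 b2 r > 1"
      by (rule Lambda2_gt_1_near_1[OF pos])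
  qed
next
  case 5
  show ?case using pos rs by (meson less_asym)
next
  case 6
  show ?case using pos rs by (meson less_asym)
next
  case 7
  show ?case using pos rs Lambda3_compare_iff(1)[OF pos(1,2) rs(1), of b2] by (meson less_asym)
next
  case 8
  show ?case using pos rs Lambda3_compare_iff(2)[OF pos(1,2) rs(2), of b2] by (meson less_asym)
next
  case 9
  show ?case
  proof (intro allI impI conjI)
    fix a b1 b2 :: real assume pos: "a > 0" "b1 > 0" "b1 < b2"
    show "strict_mono_on {0<..<1} (f4 a b1 b2)"
      by (rule pos_power_series.strict_mono[OF f4_power_series[OF pos]])
  qed (rule f4_image)
next
  case 10
  show ?case
  proof (intro allI impI ballI, goal_cases)
    case (1 a b1 b2 r)
    show ?case
    proof (cases "b1 = b2")
      case True
      thus ?thesis using 1 f4_diagonal[of a b1 r]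
        by (simp add: Let_def diagonal Lambda3_conv_f4 Lambda2_conv_f4)
    next
      case False
      hence "b1 < b2" using 1 by simp
      from Lambda_bounds_strict[OF 1(1,2) this 1(4)] False show ?thesis
        by (simp add: Let_def less_imp_le less_imp_neq)
    qed
  qed
next
  case 11
  show ?case
  proof (intro allI impI, goal_cases)
    case (1 a b1 b2)
    define F where "F = hyp2F1 a b1 (a + b1)"
    define L2 where "L2 = Lambda2 a b1 b2"
    \<comment> \<open>Dividing by F r > 0 turns a bound of shape (A) into one of shape (B), so
      \<open>best_constants\<close> serves both.\<close>
    have L3: "x * (F r - y) \<le> Lambda3 a b1 b2 r \<longleftrightarrow> x * (1 - y / F r) \<le> L2 r"
        "Lambda3 a b1 b2 r \<le> x * (F r - y) \<longleftrightarrow> L2 r \<le> x * (1 - y / F r)" if r: "r \<in> {0<..<1}" for x y r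
    proof -
      have F: "F r > 0" using hyp2F1_gt_1[OF 1(1,2) r] by (simp add: F_def)
      have l3: "Lambda3 a b1 b2 r = L2 r * F r" by (simp add: Lambda3_def L2_def F_def)
      have eq: "x * (F r - y) = x * (1 - y / F r) * F r" using F by (simp add: field_simps)
      show "x * (F r - y) \<le> Lambda3 a b1 b2 r \<longleftrightarrow> x * (1 - y / F r) \<le> L2 r"
        "Lambda3 a b1 b2 r \<le> x * (F r - y) \<longleftrightarrow> L2 r \<le> x * (1 - y / F r)"
        unfolding l3 eq using F by (simp_all only: mult_le_cancel_right_pos)
    qed
    note best = best_constants[OF 1, folded F_def L2_def]
    have "alpha_bar a b1 b2 \<le> \<alpha>'" if "\<forall>r\<in>{0<..<1}. L2 r \<le> \<alpha>'" for \<alpha>'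
      using best(3)[of \<alpha>' 0] that by simp
    moreover have "(L2 \<longlongrightarrow> alpha_bar a b1 b2) (at_left 1)"
      unfolding L2_def by (rule Lambda2_tendsto[OF 1])
    moreover have "((\<lambda>r. alpha_bar a b1 b2 * (1 - c / F r)) \<longlongrightarrow> alpha_bar a b1 b2) (at_left 1)" for c
      unfolding F_def by (rule one_minus_quotient_tendsto[OF 1(1,2)])
    ultimately show ?case
      unfolding Let_def F_def[symmetric] L2_def[symmetric]
      by (intro conjI allI impI) (auto simp: L3 intro: best)
  qed
next
  case 12
  show ?case
  proof (intro allI impI ballI, goal_cases)
    case (1 b1 b2 r)
    hence b2: "b2 > 0" by simp
    note lims = alpha_bar_tendsto[OF 1(1) b2] beta_bar_tendsto[OF 1(1), of b2] eta_bar_tendsto[OF 1(1) b2]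
      Lambda2_tendsto_a_0[OF 1(1) b2 1(3)]
    show ?case
      unfolding Let_def
      \<comment> \<open>The common limit is 1 in all three cases, as \<alpha> and F tend to 1 while
        \<beta> and \<eta> tend to 0.\<close>
      by (intro conjI exI[of _ 1]) (auto intro!: tendsto_eq_intros lims)
  qed
next
  case 13
  show ?case using b_bar_gt_1 by blast
next
  case 14
  show ?case
  proof (intro allI impI, goal_cases)
    case (1 a b1 b2)
    interpret pos_power_series "f4_fps a b1 b2" "f4 a b1 b2" "alpha_bar a b1 b2 * beta_bar a b1 b2"
      by (rule f4_power_series[OF 1])
    show ?case
    proof (rule exI[of _ "fps_nth (f4_fps a b1 b2)"], intro conjI impI ballI allI, goal_cases)
      case (1 r)
      thus ?case by (intro f_sums) auto
    next
      case 2
      show ?case by (rule absolutely_monotone)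
    next
      case 3
      show ?case by (rule f4_image[OF \<open>a > 0\<close> \<open>b1 > 0\<close> \<open>b1 < b2\<close>])
    next
      case (4 n r)
      show ?case unfolding Let_def
        by (intro conjI f4_partial_sums[OF \<open>a > 0\<close> \<open>b1 > 0\<close> \<open>b1 < b2\<close> 4(2)])
    qed
  qed
  qed
qed

end
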